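(* Let $f\in C^2((0,\infty))$ be real-valued with $f(x)>0$ for all $x\in(0,\infty)$, and let $g:(0,\infty)\to\mathbb{C}$ be continuous. Assume that $\psi_{f,g}\in L^1(0,\infty)$. Then there exist two solutions $u_1$ and $u_2$ of $$u''(x)=(f(x)+g(x))\,u(x),\qquad x\in(0,\infty),$$ such that, setting $v_j(x):=|f(x)|^{1/4}u_j(x)$ for $j=1,2$, as $x\downarrow 0$, $$e^{-\int_x^1|f(r)|^{1/2}\,dr}\,v_1(x)\to 1,\qquad |f(x)|^{-1/2}e^{-\int_x^1|f(r)|^{1/2}\,dr}\,v_1'(x)\to -1,$$ $$e^{\int_x^1|f(r)|^{1/2}\,dr}\,v_2(x)\to 1,\qquad |f(x)|^{-1/2}e^{\int_x^1|f(r)|^{1/2}\,dr}\,v_2'(x)\to 1.$$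
   Context: The function $\psi_{f,g}$ is defined by $$\psi_{f,g}(x):=|f(x)|^{-1/4}\left(-\frac{d^2}{dx^2}\bigl(|f|^{-1/4}\bigr)(x)+g(x)\,|f(x)|^{-1/4}\right).$$ A solution is a twice continuously differentiable complex-valued function on $(0,\infty)$ satisfying the equation pointwise. $L^1(I)$ denotes the absolutely integrable functions on the interval $I$. *)

theory Defs
  imports "HOL-Analysis.Analysis"
begin

text \<open>
  Functions on an open set \<open>I\<close> of reals are modelled by total functions; only their values on
  \<open>I\<close> matter, and \<open>C2_on\<close> is meant for open \<open>I\<close>, as it takes derivatives at \<open>x\<close> without
  restriction to \<open>I\<close>.
\<close>

definition C2_on :: "real set \<Rightarrow> (real \<Rightarrow> 'a::real_normed_vector) \<Rightarrow> bool" where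
  "C2_on I u \<longleftrightarrow>
     (\<exists>u' u''. (\<forall>x\<in>I. (u has_vector_derivative u' x) (at x)) \<and>
               (\<forall>x\<in>I. (u' has_vector_derivative u'' x) (at x)) \<and>
               continuous_on I u'')"

definition second_deriv :: "(real \<Rightarrow> 'a::real_normed_vector) \<Rightarrow> real \<Rightarrow> 'a" where
  "second_deriv u x = vector_derivative (\<lambda>y. vector_derivative u (at y)) (at x)"

definition psi :: "(real \<Rightarrow> real) \<Rightarrow> (real \<Rightarrow> complex) \<Rightarrow> real \<Rightarrow> complex" where
  "psi f g x =
     of_real (\<bar>f x\<bar> powr (-1/4)) *
     (- of_real (second_deriv (\<lambda>y. \<bar>f y\<bar> powr (-1/4)) x) + g x * of_real (\<bar>f x\<bar> powr (-1/4)))"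

definition is_solution :: "(real \<Rightarrow> real) \<Rightarrow> (real \<Rightarrow> complex) \<Rightarrow> (real \<Rightarrow> complex) \<Rightarrow> bool" where
  "is_solution f g u \<longleftrightarrow>
     C2_on {0<..} u \<and> (\<forall>x>0. second_deriv u x = (of_real (f x) + g x) * u x)"

end

theory Submission
  imports Defs
begin

text \<open>
  With \<open>r = f powr (1/2)\<close>, \<open>\<xi>(x)\<close> the integral of \<open>r\<close> over \<open>[x, 1]\<close>, \<open>v = f powr (1/4) * u\<close> and
  \<open>p = v' / r\<close>, the equation becomes the system \<open>v' = r p\<close>, \<open>p' = (r + \<psi>) v\<close>, an integrable
  perturbation of \<open>v' = r p\<close>, \<open>p' = r v\<close>. The recessive solution comes from a Volterra equation
  started at \<open>0\<close> for \<open>w = exp \<xi> * v\<close>, whose kernel is bounded because \<open>\<xi>\<close> is decreasing; this needs no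
  distinction between \<open>\<xi>(0+)\<close> finite or infinite. A second solution \<open>y\<close> with Wronskian \<open>-2\<close> satisfies
  \<open>(y / v)' = -2 r / v\<^sup>2\<close>, which is asymptotic to \<open>(exp (2 \<xi>))'\<close>. Hence \<open>y / v + c\<close> is asymptotic to
  \<open>exp (2 \<xi>)\<close>: for every \<open>c\<close> if \<open>\<xi>(0+)\<close> is infinite, and for the right constant \<open>c\<close> if it is finite.
  So \<open>y + c v\<close> is the dominant solution.
\<close>

section \<open>Fixed points and antiderivatives on the half-line\<close>

text \<open>Banach's fixed point theorem in the norm \<open>sup |u| / \<phi>\<close>. Stating
  \<open>contr\<close> for an arbitrary bound \<open>M\<close> instead of a supremum lets it be
  verified by pointwise estimates.\<close>

lemma weighted_fixed_point:
  fixes P :: "(real \<Rightarrow> complex) \<Rightarrow> real \<Rightarrow> complex" and \<phi> :: "real \<Rightarrow> real"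
  defines "E \<equiv> {u. continuous_on {0<..} u \<and> (\<exists>M. \<forall>x>0. norm (u x) \<le> M * \<phi> x)}"
  assumes cont: "continuous_on {0<..} \<phi>" and pos: "\<And>x. x > 0 \<Longrightarrow> \<phi> x > 0"
    and maps: "\<And>u. u \<in> E \<Longrightarrow> continuous_on {0<..} (P u)"
    and zero: "\<And>x. x > 0 \<Longrightarrow> norm (P (\<lambda>_. 0) x) \<le> C * \<phi> x"
    and contr: "\<And>u v M x. \<lbrakk>u \<in> E; v \<in> E; \<forall>y>0. norm (u y - v y) \<le> M * \<phi> y; x > 0\<rbrakk>
      \<Longrightarrow> norm (P u x - P v x) \<le> M / 2 * \<phi> x"
  shows "\<exists>u\<in>E. \<forall>x>0. u x = P u x"
proof -
  define U where "U e x = of_real (\<phi> x) * apply_bcontfun e (ln x)" for e :: "real \<Rightarrow>\<^sub>C complex" and x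
  \<comment> \<open>\<open>x = exp t\<close> turns weighted functions on the half-line into bounded continuous functions on \<open>\<real>\<close>.\<close>
  define Q where "Q e = Bcontfun (\<lambda>t. P (U e) (exp t) / of_real (\<phi> (exp t)))" for e
  have nz: "complex_of_real (\<phi> (exp t)) \<noteq> 0" "\<phi> (exp t) > 0" for t
    using pos[of "exp t"] by auto
  have UE: "U e \<in> E" for e
  proof -
    have "norm (U e x) \<le> norm e * \<phi> x" if "x > 0" for x
      using norm_bounded[of e "ln x"] pos[OF that]
      by (simp add: U_def norm_mult mult.commute mult_left_mono)
    moreover have "continuous_on {0<..} (U e)"
      unfolding U_def
      by (intro continuous_intros cont continuous_on_compose2[of UNIV "apply_bcontfun e" _ ln]) auto
    ultimately show ?thesis
      unfolding E_def by blast
  qed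
  have Uexp: "U e (exp t) / of_real (\<phi> (exp t)) = apply_bcontfun e t" for e t
    using nz[of t] by (simp add: U_def)
  have Udiff: "norm (U e x - U e' x) \<le> dist e e' * \<phi> x" if "x > 0" for e e' x
    using dist_bounded[of e "ln x" e'] pos[OF that]
    by (simp add: U_def dist_norm norm_mult mult.commute mult_left_mono flip: right_diff_distrib)
  have Qmem: "(\<lambda>t. P (U e) (exp t) / of_real (\<phi> (exp t))) \<in> bcontfun" for e
  proof -
    have z: "(\<lambda>_. 0) \<in> E"
      by (auto simp: E_def intro: exI[of _ 0])
    obtain M where M: "\<forall>x>0. norm (U e x) \<le> M * \<phi> x"
      using UE[of e] E_def by auto
    \<comment> \<open>Comparison with the image of the zero function, which \<open>zero\<close>
      controls, keeps \<open>P (U e)\<close> in the weighted space.\<close>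
    have "norm (P (U e) x) \<le> (M / 2 + C) * \<phi> x" if "x > 0" for x
      using contr[OF UE z, of e M x] M that zero[OF that]
        norm_triangle_sub[of "P (U e) x" "P (\<lambda>_. 0) x"] by (simp add: algebra_simps)
    then have "norm (P (U e) (exp t) / of_real (\<phi> (exp t))) \<le> M / 2 + C" for t
      using nz[of t] by (simp add: norm_divide divide_le_eq)
    moreover have "\<phi> (exp t) \<noteq> 0" for t
      using nz(2)[of t] by simp
    then have "continuous_on UNIV (\<lambda>t. P (U e) (exp t) / of_real (\<phi> (exp t)))"
      by (intro continuous_intros continuous_on_compose2[OF maps[OF UE]]
          continuous_on_compose2[OF cont]) auto
    ultimately show ?thesis
      by (intro bcontfun_normI)
  qed
  have "dist (Q e) (Q e') \<le> 1/2 * dist e e'" for e e'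
  proof (rule dist_bound)
    fix t
    have "norm (P (U e) (exp t) - P (U e') (exp t)) \<le> dist e e' / 2 * \<phi> (exp t)"
      by (rule contr[OF UE UE]) (auto simp: Udiff)
    then show "dist (apply_bcontfun (Q e) t) (apply_bcontfun (Q e') t) \<le> 1/2 * dist e e'"
      using nz[of t]
      by (simp add: Q_def Bcontfun_inverse[OF Qmem] dist_norm norm_divide divide_le_eq
          flip: diff_divide_distrib)
  qed
  then obtain e where e: "Q e = e"
    using banach_fix_type[of "1/2" Q] by auto
  have "U e x = P (U e) x" if "x > 0" for x
  proof -
    have "apply_bcontfun e (ln x) = P (U e) (exp (ln x)) / of_real (\<phi> (exp (ln x)))"
      by (subst e[symmetric], unfold Q_def Bcontfun_inverse[OF Qmem]) simp
    then show ?thesis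
      using that pos[OF that] by (simp add: U_def)
  qed
  then show ?thesis using UE by blast
qed

lemma norm_le_of_derivative_le:
  fixes F G :: "real \<Rightarrow> complex" and K L :: "real \<Rightarrow> real"
  assumes "x0 > 0" "x \<ge> x0"
    and F: "\<And>x. x > 0 \<Longrightarrow> (F has_vector_derivative G x) (at x)"
    and K: "\<And>x. x > 0 \<Longrightarrow> (K has_vector_derivative L x) (at x)"
    and le: "\<And>x. x > x0 \<Longrightarrow> norm (G x) \<le> L x"
    and init: "F x0 = 0" "0 \<le> K x0"
  shows "norm (F x) \<le> K x"
proof (cases "x = x0")
  case False
  have "norm (F x - F x0) \<le> K x - K x0"
  proof (rule differentiable_bound_general[where f' = G and \<phi>' = L])
    show "continuous_on {x0..x} F" "continuous_on {x0..x} K"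
      using assms(1) by (auto intro!: continuous_at_imp_continuous_on
          has_vector_derivative_continuous[OF F] has_vector_derivative_continuous[OF K])
  qed (use assms False in auto)
  then show ?thesis using init by auto
qed (use init in auto)

text \<open>Two mean value inequalities: \<open>G\<close> against \<open>L\<close>, then
  \<open>F\<close> against \<open>K\<close>. To the left of \<open>x0\<close> the sign changes
  twice, so the bound is again \<open>K\<close>, and one statement serves both sides of the starting
  point.\<close>

lemma second_order_comparison:
  fixes F G E :: "real \<Rightarrow> complex" and K L N r :: "real \<Rightarrow> real"
  assumes x0: "x0 > 0"
    and F: "\<And>x. x > 0 \<Longrightarrow> (F has_vector_derivative r x *\<^sub>R G x) (at x)"
    and G: "\<And>x. x > 0 \<Longrightarrow> (G has_vector_derivative E x) (at x)"
    and K: "\<And>x. x > 0 \<Longrightarrow> (K has_vector_derivative r x * L x) (at x)"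
    and L: "\<And>x. x > 0 \<Longrightarrow> (L has_vector_derivative N x) (at x)"
    and r: "\<And>x. x > 0 \<Longrightarrow> r x \<ge> 0"
    and le: "\<And>x. x > 0 \<Longrightarrow> norm (E x) \<le> N x"
    and init: "F x0 = 0" "G x0 = 0" "K x0 = 0" "L x0 = 0"
    and x: "x > 0"
  shows "norm (F x) \<le> K x"
proof (cases "x \<ge> x0")
  case True
  show ?thesis
  proof (rule norm_le_of_derivative_le[OF x0 True F K])
    fix y assume "y > x0"
    then have "norm (G y) \<le> L y"
      using x0 by (intro norm_le_of_derivative_le[OF x0 _ G L le]) (auto simp: init)
    then show "norm (r y *\<^sub>R G y) \<le> r y * L y"
      using r[of y] x0 \<open>y > x0\<close> by (simp add: mult_left_mono)
  qed (auto simp: init)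
next
  case False
  have Gy: "norm (G y) \<le> - L y" if "y < x0" "y > 0" for y
  proof -
    have "norm (G x0 - G y) \<le> L x0 - L y"
    proof (rule differentiable_bound_general[where f' = E and \<phi>' = N])
      show "continuous_on {y..x0} G" "continuous_on {y..x0} L"
        using that by (auto intro!: continuous_at_imp_continuous_on
            has_vector_derivative_continuous[OF G] has_vector_derivative_continuous[OF L])
    qed (use that G L le in auto)
    then show ?thesis by (simp add: init)
  qed
  \<comment> \<open>Left of \<open>x0\<close> the majorant is \<open>- K\<close>: its derivative
    \<open>- (r y * L y)\<close> is nonnegative there, because \<open>- L\<close> bounds a
    norm.\<close>
  have "norm (F x0 - F x) \<le> (- K x0) - (- K x)"
  proof (rule differentiable_bound_general)
    show "continuous_on {x..x0} F" "continuous_on {x..x0} (\<lambda>x. - K x)"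
      using x by (auto intro!: continuous_at_imp_continuous_on continuous_intros
          has_vector_derivative_continuous[OF F] has_vector_derivative_continuous[OF K])
    fix y assume y: "x < y" "y < x0"
    show "(F has_vector_derivative r y *\<^sub>R G y) (at y)"
      using y x F by auto
    show "((\<lambda>x. - K x) has_vector_derivative - (r y * L y)) (at y)"
      using y x by (intro derivative_intros K) auto
    show "norm (r y *\<^sub>R G y) \<le> - (r y * L y)"
      using mult_left_mono[OF Gy r, of y y] y x r[of y] by simp
  qed (use False in auto)
  then show ?thesis by (simp add: init)
qed

lemma antiderivative_exists:
  fixes f :: "real \<Rightarrow> 'a::euclidean_space"
  assumes "continuous_on {0<..} f" and x0: "x0 > 0"
  shows "\<exists>F. F x0 = 0 \<and> (\<forall>x>0. (F has_vector_derivative f x) (at x))"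
proof -
  have "\<exists>F. \<forall>x. (0::ereal) < x \<longrightarrow> x < \<infinity> \<longrightarrow> (F has_vector_derivative f x) (at x)"
    using assms by (intro einterval_antiderivative) (auto simp: continuous_on_eq_continuous_at)
  then obtain F where F: "\<And>x. x > 0 \<Longrightarrow> (F has_vector_derivative f x) (at x)"
    by auto
  have "((\<lambda>x. F x - F x0) has_vector_derivative f x) (at x)" if "x > 0" for x
    using has_vector_derivative_diff[OF F[OF that] has_vector_derivative_const] by simp
  then show ?thesis by (intro exI[of _ "\<lambda>x. F x - F x0"]) auto
qed

text \<open>This serves two purposes: linearity of an antiderivative operator that is fixed only by
  its value at \<open>x0\<close>, and constancy of a Wronskian.\<close>

lemma antiderivative_unique:
  fixes F G h :: "real \<Rightarrow> 'a::real_normed_vector"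
  assumes "x0 > 0" "F x0 = 0" "G x0 = 0" "y > 0"
    and F: "\<And>x. x > 0 \<Longrightarrow> (F has_vector_derivative h x) (at x)"
    and G: "\<And>x. x > 0 \<Longrightarrow> (G has_vector_derivative h x) (at x)"
  shows "F y = G y"
proof -
  have "((\<lambda>x. F x - G x) has_vector_derivative 0) (at x within {0<..})" if "x \<in> {0<..}" for x
    using has_vector_derivative_diff[OF F G] that
    by (auto intro: has_vector_derivative_at_within)
  then obtain c where "\<And>x. x \<in> {0<..} \<Longrightarrow> F x - G x = c"
    using has_vector_derivative_zero_constant[of "{0<..}" "\<lambda>x. F x - G x"] by auto
  then have "F x0 - G x0 = c" "F y - G y = c"
    using assms(1,4) by auto
  then show ?thesis using assms(2,3) by simp
qed

section \<open>Initial value problems\<close>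

text \<open>The Picard integral operator is a contraction on the whole half-line at once in a weight
  that grows fast enough on both sides of \<open>x0\<close>. The lemma supplies the second solution,
  with prescribed data at a point where the recessive one does not vanish.\<close>

lemma sturm_liouville_ivp:
  fixes r :: "real \<Rightarrow> real" and m :: "real \<Rightarrow> complex" and a b :: complex
  assumes r: "continuous_on {0<..} r" "\<And>x. x > 0 \<Longrightarrow> r x \<ge> 0"
    and m: "continuous_on {0<..} m" and x0: "x0 > 0"
  shows "\<exists>v p. v x0 = a \<and> p x0 = b \<and>
    (\<forall>x>0. (v has_vector_derivative r x *\<^sub>R p x) (at x) \<and>
           (p has_vector_derivative m x * v x) (at x))"
proof -
  \<comment> \<open>\<open>I f\<close> is the antiderivative vanishing at \<open>x0\<close>, which
    avoids oriented integrals for arguments left of \<open>x0\<close>.\<close>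
  define I where "I f = (SOME F. F x0 = 0 \<and> (\<forall>x>0. (F has_vector_derivative f x) (at x)))"
    for f :: "real \<Rightarrow> complex"
  have I: "I f x0 = 0" "\<And>x. x > 0 \<Longrightarrow> (I f has_vector_derivative f x) (at x)"
    if "continuous_on {0<..} f" for f
    using someI_ex[OF antiderivative_exists[OF that x0], folded I_def] by auto
  have cont_of_deriv: "continuous_on {0<..} F"
    if "\<And>x. x > 0 \<Longrightarrow> (F has_vector_derivative f x) (at x)" for F f :: "real \<Rightarrow> 'c::real_normed_vector"
    using that by (auto intro!: continuous_at_imp_continuous_on has_vector_derivative_continuous)
  have I_cont: "continuous_on {0<..} (I f)" if "continuous_on {0<..} f" for f
    using cont_of_deriv I(2)[OF that] by blast

  obtain s where s: "s x0 = 0" "\<And>x. x > 0 \<Longrightarrow> (s has_vector_derivative r x) (at x)"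
    using antiderivative_exists[OF r(1) x0] by auto
  \<comment> \<open>\<open>h\<close> solves the problem with \<open>m = 0\<close> and the given
    data; the unknown becomes the correction \<open>v - h\<close>.\<close>
  define h where "h x = a + s x *\<^sub>R b" for x
  have h: "h x0 = a" "\<And>x. x > 0 \<Longrightarrow> (h has_vector_derivative r x *\<^sub>R b) (at x)"
    unfolding h_def using s has_vector_derivative_real_field
    by (auto intro!: derivative_eq_intros simp: has_real_derivative_iff_has_vector_derivative)
  note h_cont = cont_of_deriv[OF h(2)]

  \<comment> \<open>The weight \<open>\<phi> = exp \<theta>\<close> satisfies \<open>(\<phi>' / r)' \<ge> 2 \<bar>m\<bar> \<phi>\<close>, so the integral operator halves the weighted norm;
    the factor \<open>1 + \<bar>h\<bar>\<close> puts the inhomogeneity in the weighted space.\<close>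
  define N0 where "N0 x = 2 * norm (m x) * (1 + norm (h x))" for x
  have N0: "continuous_on {0<..} N0" "\<And>x. N0 x \<ge> 2 * norm (m x)" "\<And>x. N0 x \<ge> 2 * norm (m x * h x)" "\<And>x. N0 x \<ge> 0"
    unfolding N0_def by (auto intro!: continuous_intros m h_cont simp: norm_mult algebra_simps)
  obtain \<eta> where \<eta>: "\<eta> x0 = 0" "\<And>x. x > 0 \<Longrightarrow> (\<eta> has_vector_derivative N0 x) (at x)"
    using antiderivative_exists[OF N0(1) x0] by auto
  have "continuous_on {0<..} (\<lambda>x. r x * \<eta> x)"
    by (intro continuous_intros r cont_of_deriv[OF \<eta>(2)])
  then obtain \<theta> where \<theta>: "\<theta> x0 = 0" "\<And>x. x > 0 \<Longrightarrow> (\<theta> has_vector_derivative r x * \<eta> x) (at x)"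
    using antiderivative_exists[OF _ x0] by blast
  \<comment> \<open>Comparing the zero function with \<open>\<theta>\<close> gives the sign on both
    sides of \<open>x0\<close>.\<close>
  have \<theta>_nonneg: "\<theta> x \<ge> 0" if "x > 0" for x
  proof -
    have "norm (0::complex) \<le> \<theta> x"
      by (rule second_order_comparison[OF x0, of "\<lambda>_. 0" r "\<lambda>_. 0" "\<lambda>_. 0" \<theta> \<eta> N0])
        (use that r \<theta> \<eta> N0 in auto)
    then show ?thesis by simp
  qed
  define \<phi> where "\<phi> x = exp (\<theta> x)" for x
  have \<phi>: "\<phi> x0 = 1" "\<And>x. \<phi> x > 0" "\<And>x. x > 0 \<Longrightarrow> \<phi> x \<ge> 1"
    "\<And>x. x > 0 \<Longrightarrow> (\<phi> has_vector_derivative r x * (\<eta> x * \<phi> x)) (at x)"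
    using \<theta>_nonneg \<theta> unfolding \<phi>_def
    by (auto intro!: derivative_eq_intros simp: has_real_derivative_iff_has_vector_derivative[symmetric])
  note \<phi>_cont = cont_of_deriv[OF \<phi>(4)]
  have dom: "norm (I (\<lambda>y. r y *\<^sub>R I E y) x) \<le> M / 2 * \<phi> x"
    if E: "continuous_on {0<..} E" and le: "\<And>x. x > 0 \<Longrightarrow> norm (E x) \<le> M / 2 * N0 x * \<phi> x"
      and "M \<ge> 0" "x > 0" for E M x
  proof -
    \<comment> \<open>The majorant \<open>M / 2 * (\<phi> x - 1)\<close> vanishes at
      \<open>x0\<close> together with its derivative divided by \<open>r\<close>. Differentiating
      that quotient gives \<open>M / 2 * N0 x * \<phi> x\<close> plus a nonnegative term containing
      the square of \<open>\<eta>\<close>.\<close>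
    have "norm (I (\<lambda>y. r y *\<^sub>R I E y) x) \<le> M / 2 * (\<phi> x - 1)"
    proof (rule second_order_comparison[OF x0, where F = "I (\<lambda>y. r y *\<^sub>R I E y)" and G = "I E" and E = E and r = r and
          K = "\<lambda>x. M / 2 * (\<phi> x - 1)" and L = "\<lambda>x. M / 2 * (\<eta> x * \<phi> x)" and
          N = "\<lambda>x. M / 2 * (N0 x * \<phi> x + \<eta> x * (r x * (\<eta> x * \<phi> x)))"])
      have rI: "continuous_on {0<..} (\<lambda>y. r y *\<^sub>R I E y)"
        by (intro continuous_intros r I_cont E)
      show "I (\<lambda>y. r y *\<^sub>R I E y) x0 = 0" "I E x0 = 0"
        using I(1) rI E by auto
      fix x :: real assume x: "x > 0"
      show "(I (\<lambda>y. r y *\<^sub>R I E y) has_vector_derivative r x *\<^sub>R I E x) (at x)"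
        "(I E has_vector_derivative E x) (at x)"
        using I(2) x rI E by auto
      show "((\<lambda>x. M / 2 * (\<phi> x - 1)) has_vector_derivative r x * (M / 2 * (\<eta> x * \<phi> x))) (at x)"
        using \<phi>(4)[OF x] by (auto intro!: derivative_eq_intros
            simp: has_real_derivative_iff_has_vector_derivative[symmetric])
      show "((\<lambda>x. M / 2 * (\<eta> x * \<phi> x)) has_vector_derivative
          M / 2 * (N0 x * \<phi> x + \<eta> x * (r x * (\<eta> x * \<phi> x)))) (at x)"
        using \<phi>(4)[OF x] \<eta>(2)[OF x] by (auto intro!: derivative_eq_intros
            simp: has_real_derivative_iff_has_vector_derivative[symmetric])
      have "0 \<le> M / 2 * (r x * (\<eta> x)\<^sup>2 * \<phi> x)"
        using x r \<phi>(2)[of x] \<open>M \<ge> 0\<close> by (intro mult_nonneg_nonneg) auto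
      then show "norm (E x) \<le> M / 2 * (N0 x * \<phi> x + \<eta> x * (r x * (\<eta> x * \<phi> x)))"
        using le[OF x] by (simp add: algebra_simps power2_eq_square)
    qed (use r \<phi> \<eta> that in auto)
    then show ?thesis using \<open>M \<ge> 0\<close> by (simp add: algebra_simps)
  qed
  \<comment> \<open>A fixed point \<open>u\<close> is the correction in \<open>v = h + u\<close>:
    the inner antiderivative corrects \<open>p\<close>, the outer one corrects
    \<open>v\<close>.\<close>
  define P where "P u = I (\<lambda>x. r x *\<^sub>R I (\<lambda>y. m y * (h y + u y)) x)" for u
  have mu: "continuous_on {0<..} (\<lambda>y. m y * (h y + u y))"
    and rmu: "continuous_on {0<..} (\<lambda>x. r x *\<^sub>R I (\<lambda>y. m y * (h y + u y)) x)"
    if "continuous_on {0<..} u" for u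
    using that by (auto intro!: continuous_intros I_cont r m h_cont)
  \<comment> \<open>\<open>I\<close> is a choice, so its linearity comes from uniqueness of
    antiderivatives, applied to the inner and then to the outer integration.\<close>
  have Pdiff: "P u x - P v x = I (\<lambda>y. r y *\<^sub>R I (\<lambda>y. m y * (u y - v y)) y) x"
    if u: "continuous_on {0<..} u" and v: "continuous_on {0<..} v" and x: "x > 0" for u v x
  proof -
    have inner: "I (\<lambda>y. m y * (h y + u y)) y - I (\<lambda>y. m y * (h y + v y)) y = I (\<lambda>y. m y * (u y - v y)) y"
      if "y > 0" for y
    proof (rule antiderivative_unique[OF x0, where h = "\<lambda>y. m y * (u y - v y)"])
      fix x :: real assume "x > 0"
      then show "((\<lambda>y. I (\<lambda>y. m y * (h y + u y)) y - I (\<lambda>y. m y * (h y + v y)) y)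
          has_vector_derivative m x * (u x - v x)) (at x)"
        using has_vector_derivative_diff[OF I(2)[OF mu[OF u]] I(2)[OF mu[OF v]]]
        by (simp add: right_diff_distrib distrib_left)
      show "(I (\<lambda>y. m y * (u y - v y)) has_vector_derivative m x * (u x - v x)) (at x)"
        by (intro I continuous_intros m u v \<open>x > 0\<close>)
    qed (use that in \<open>auto simp: I mu u v intro!: I continuous_intros m u v\<close>)
    have muv: "continuous_on {0<..} (\<lambda>y. m y * (u y - v y))"
      by (intro continuous_intros m u v)
    have rmuv: "continuous_on {0<..} (\<lambda>y. r y *\<^sub>R I (\<lambda>y. m y * (u y - v y)) y)"
      by (intro continuous_intros I_cont muv r)
    show ?thesis unfolding P_def
    proof (rule antiderivative_unique[OF x0, where h = "\<lambda>y. r y *\<^sub>R I (\<lambda>y. m y * (u y - v y)) y"])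
      fix x :: real assume x: "x > 0"
      have "((\<lambda>x. I (\<lambda>x. r x *\<^sub>R I (\<lambda>y. m y * (h y + u y)) x) x - I (\<lambda>x. r x *\<^sub>R I (\<lambda>y. m y * (h y + v y)) x) x)
          has_vector_derivative r x *\<^sub>R I (\<lambda>y. m y * (h y + u y)) x - r x *\<^sub>R I (\<lambda>y. m y * (h y + v y)) x) (at x)"
        by (intro derivative_intros I rmu u v x)
      then show "((\<lambda>x. I (\<lambda>x. r x *\<^sub>R I (\<lambda>y. m y * (h y + u y)) x) x - I (\<lambda>x. r x *\<^sub>R I (\<lambda>y. m y * (h y + v y)) x) x)
          has_vector_derivative r x *\<^sub>R I (\<lambda>y. m y * (u y - v y)) x) (at x)"
        by (simp add: inner[OF x] flip: scaleR_diff_right)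
      show "(I (\<lambda>y. r y *\<^sub>R I (\<lambda>y. m y * (u y - v y)) y) has_vector_derivative
          r x *\<^sub>R I (\<lambda>y. m y * (u y - v y)) x) (at x)"
        using I(2)[OF rmuv x] .
    qed (use x in \<open>auto simp: I rmuv rmu u v\<close>)
  qed
  have "\<exists>u\<in>{u :: real \<Rightarrow> complex. continuous_on {0<..} u \<and> (\<exists>M. \<forall>x>0. norm (u x) \<le> M * \<phi> x)}. \<forall>x>0. u x = P u x"
  proof (rule weighted_fixed_point[where C = "1/2"])
    fix u assume "u \<in> {u :: real \<Rightarrow> complex. continuous_on {0<..} u \<and> (\<exists>M. \<forall>x>0. norm (u x) \<le> M * \<phi> x)}"
    then show "continuous_on {0<..} (P u)"
      unfolding P_def by (intro I_cont rmu) auto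
  next
    fix x :: real assume x: "x > 0"
    show "norm (P (\<lambda>_. 0) x) \<le> 1 / 2 * \<phi> x"
      unfolding P_def
    proof (rule dom)
      fix y :: real assume "y > 0"
      \<comment> \<open>This is \<open>dom\<close> with \<open>M = 1\<close>; the factor
        \<open>1 + |h|\<close> in \<open>N0\<close> absorbs the inhomogeneity, and
        \<open>\<phi> \<ge> 1\<close>.\<close>
      have "norm (m y * (h y + 0)) \<le> 1 / 2 * N0 y"
        using N0(3)[of y] by simp
      also have "\<dots> \<le> 1 / 2 * N0 y * \<phi> y"
        using \<phi>(3)[OF \<open>y > 0\<close>] N0(4)[of y] by (simp add: mult_le_cancel_left1 less_le)
      finally show "norm (m y * (h y + 0)) \<le> 1 / 2 * N0 y * \<phi> y" .
    qed (use x mu[of "\<lambda>_. 0"] in auto)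
  next
    fix u v M and x :: real
    assume u: "u \<in> {u :: real \<Rightarrow> complex. continuous_on {0<..} u \<and> (\<exists>M. \<forall>x>0. norm (u x) \<le> M * \<phi> x)}"
      and v: "v \<in> {u :: real \<Rightarrow> complex. continuous_on {0<..} u \<and> (\<exists>M. \<forall>x>0. norm (u x) \<le> M * \<phi> x)}"
      and le: "\<forall>y>0. norm (u y - v y) \<le> M * \<phi> y" and x: "x > 0"
    show "norm (P u x - P v x) \<le> M / 2 * \<phi> x"
    proof (subst Pdiff, use u in force, use v in force, use x in force, rule dom)
      show "M \<ge> 0"
        using le[rule_format, OF x] \<phi>(2)[of x] norm_ge_zero[of "u x - v x"]
        by (smt (verit) mult_neg_pos)
      fix y :: real assume "y > 0"
      have "norm (m y) * norm (u y - v y) \<le> norm (m y) * (M * \<phi> y)"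
        using le \<open>y > 0\<close> by (intro mult_left_mono) auto
      \<comment> \<open>The factor 2 in \<open>N0\<close> becomes the contraction constant 1/2
        here.\<close>
      also have "\<dots> \<le> (N0 y / 2) * (M * \<phi> y)"
        using N0(2)[of y] \<open>M \<ge> 0\<close> \<phi>(2)[of y] by (intro mult_right_mono) auto
      finally show "norm (m y * (u y - v y)) \<le> M / 2 * N0 y * \<phi> y"
        by (simp add: norm_mult mult_ac)
    qed (use u v x in \<open>auto intro!: continuous_intros m\<close>)
  qed (use \<phi> \<phi>_cont in auto)
  then obtain u where u: "continuous_on {0<..} u" and fix_u: "\<And>x. x > 0 \<Longrightarrow> u x = P u x"
    by auto
  \<comment> \<open>\<open>P u\<close> stands in place of \<open>u\<close>, which agrees with it
    only for positive arguments, so that the derivative can be read off directly.\<close>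
  define v where "v x = h x + P u x" for x
  define p where "p x = b + I (\<lambda>y. m y * (h y + u y)) x" for x
  have "v x0 = a" "p x0 = b"
    using I(1)[OF rmu[OF u]] I(1)[OF mu[OF u]] by (auto simp: v_def p_def P_def h)
  moreover have "(v has_vector_derivative r x *\<^sub>R p x) (at x)" if "x > 0" for x
    using has_vector_derivative_add[OF h(2)[OF that] I(2)[OF rmu[OF u] that]]
    by (simp add: v_def[abs_def] p_def P_def[symmetric] scaleR_add_right)
  moreover have "(p has_vector_derivative m x * v x) (at x)" if "x > 0" for x
    using has_vector_derivative_add[OF has_vector_derivative_const I(2)[OF mu[OF u] that], of b]
    by (simp add: v_def p_def[abs_def] fix_u[OF that, symmetric])
  ultimately show ?thesis by blast
qed

section \<open>The recessive solution\<close>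

text \<open>Continuity on the open half-line gives measurability, domination by
  \<open>\<rho>\<close> then gives integrability, and the endpoint 0 is negligible.\<close>

lemma improper_integral_bound:
  fixes F :: "real \<Rightarrow> complex"
  assumes F: "continuous_on {0<..} F" and \<rho>: "\<rho> integrable_on {0..x}"
    and le: "\<And>y. y \<in> {0..x} \<Longrightarrow> norm (F y) \<le> \<rho> y"
  shows "F integrable_on {0..x}" "norm (integral {0..x} F) \<le> integral {0..x} \<rho>"
proof -
  have "F integrable_on {0<..x}"
  proof (rule measurable_bounded_by_integrable_imp_integrable)
    show "F \<in> borel_measurable (lebesgue_on {0<..x})"
      by (intro continuous_imp_measurable_on_sets_lebesgue continuous_on_subset[OF F]) auto
    show "\<rho> integrable_on {0<..x}"
      using \<rho> by (rule integrable_spike_set) (auto intro: negligible_subset[of "{0}"])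
  qed (use le in auto)
  then show *: "F integrable_on {0..x}"
    by (rule integrable_spike_set) (auto intro: negligible_subset[of "{0}"])
  show "norm (integral {0..x} F) \<le> integral {0..x} \<rho>"
    using le by (rule integral_norm_bound_integral[OF * \<rho>])
qed

lemma improper_integral_has_vector_derivative:
  fixes F :: "real \<Rightarrow> 'a::euclidean_space"
  assumes F: "continuous_on {0<..} F" and int: "\<And>x. F integrable_on {0..x}" and x: "x > 0"
  shows "((\<lambda>x. integral {0..x} F) has_vector_derivative F x) (at x)"
proof -
  have "isCont F x"
    using F x by (simp add: continuous_on_eq_continuous_at)
  then have "((\<lambda>x. integral {0..x} F) has_vector_derivative F x) (at x within {0..x+1} - {})"
    using x by (intro integral_has_vector_derivative_continuous_at int)
      (auto intro: continuous_at_imp_continuous_at_within)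
  then show ?thesis
    using x by (simp add: at_within_Icc_at)
qed

text \<open>Variation of constants along the unperturbed solutions
  \<open>exp (- \<xi>) * (1, 1)\<close> and \<open>exp \<xi> * (1, -1)\<close> for the pair
  \<open>(v, p)\<close>, with both coefficients integrated from 0. The integral terms vanish at 0
  relative to \<open>exp (- \<xi>)\<close>, so the first unperturbed solution gives the
  asymptotics.\<close>

lemma recessive_solution:
  fixes r \<xi> :: "real \<Rightarrow> real" and q :: "real \<Rightarrow> complex"
  assumes r: "\<And>x. x > 0 \<Longrightarrow> r x \<ge> 0"
    and \<xi>: "\<And>x. x > 0 \<Longrightarrow> (\<xi> has_real_derivative - r x) (at x)"
    and q: "continuous_on {0<..} q" "q absolutely_integrable_on {0<..}"
  shows "\<exists>(v :: real \<Rightarrow> complex) (p :: real \<Rightarrow> complex). (\<forall>x>0. (v has_vector_derivative r x *\<^sub>R p x) (at x) \<and>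
      (p has_vector_derivative (r x + q x) * v x) (at x)) \<and>
    ((\<lambda>x. exp (\<xi> x) * v x) \<longlongrightarrow> 1) (at_right 0) \<and>
    ((\<lambda>x. exp (\<xi> x) * p x) \<longlongrightarrow> 1) (at_right 0)"
proof -
  \<comment> \<open>Nothing is known about \<open>q 0\<close>, so it is reset to \<open>0\<close> to integrate over closed intervals.\<close>
  define q0 where "q0 x = (if x > 0 then q x else 0)" for x
  have q0_cont: "continuous_on {0<..} q0"
    using q(1) by (rule continuous_on_eq) (simp add: q0_def)
  have "q0 absolutely_integrable_on {0<..}"
    using q(2) by (rule set_integrable_cong[THEN iffD1, rotated -1]) (auto simp: q0_def)
  then have "q0 absolutely_integrable_on {0<..x}" for x
    by (rule set_integrable_subset) auto
  then have "(\<lambda>y. norm (q0 y)) integrable_on {0<..x}" for x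
    by (auto simp: absolutely_integrable_on_def)
  then have nq: "(\<lambda>y. norm (q0 y)) integrable_on {0..x}" for x
    by (rule integrable_spike_set) (auto intro: negligible_subset[of "{0}"])

  \<comment> \<open>The exponential weight and the monotonicity of \<open>\<xi>\<close>\<close>
  define \<Psi> where "\<Psi> x = integral {0..x} (\<lambda>y. norm (q0 y))" for x
  \<comment> \<open>Since the derivative of \<open>\<phi>\<close> is \<open>|q0| * \<phi>\<close>,
    the integral of \<open>|q0| * \<phi>\<close> over \<open>{0..x}\<close> is
    \<open>\<phi> x - 1\<close>. A kernel bounded by 1/2 therefore contracts by 1/2, however large
    the integral of \<open>|q0|\<close> is.\<close>
  define \<phi> where "\<phi> x = exp (\<Psi> x)" for x
  have \<Psi>: "\<Psi> 0 = 0" "\<And>x. \<Psi> x \<ge> 0" "\<And>x. continuous_on {0..x} \<Psi>"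
    "\<And>x. x > 0 \<Longrightarrow> (\<Psi> has_vector_derivative norm (q0 x)) (at x)"
    unfolding \<Psi>_def using nq
    by (auto intro!: indefinite_integral_continuous_1 integral_nonneg
        improper_integral_has_vector_derivative continuous_intros q0_cont)
  have \<phi>: "\<phi> 0 = 1" "\<And>x. \<phi> x \<ge> 1" "\<And>x. \<phi> x > 0" "\<And>x. continuous_on {0..x} \<phi>"
    "\<And>x. x > 0 \<Longrightarrow> (\<phi> has_vector_derivative norm (q0 x) * \<phi> x) (at x)"
    unfolding \<phi>_def using \<Psi>
    by (auto intro!: continuous_intros derivative_eq_intros
        simp: has_real_derivative_iff_has_vector_derivative[symmetric])
  have \<phi>_cont: "continuous_on {0<..} \<phi>"
    using \<phi>(5) by (auto intro!: continuous_at_imp_continuous_on has_vector_derivative_continuous)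
  have \<phi>_int: "((\<lambda>y. norm (q0 y) * \<phi> y) has_integral \<phi> x - 1) {0..x}" if "x \<ge> 0" for x
    using fundamental_theorem_of_calculus_interior[OF that \<phi>(4),
        where f' = "\<lambda>y. norm (q0 y) * \<phi> y"] \<phi>(1,5)
    by auto
  have \<phi>_lim: "(\<phi> \<longlongrightarrow> 1) (at_right 0)"
  proof -
    have "(\<phi> \<longlongrightarrow> \<phi> 0) (at 0 within {0..1})"
      using \<phi>(4)[of 1] by (simp add: continuous_on)
    then show ?thesis by (simp add: \<phi>(1) at_within_Icc_at_right)
  qed
  have \<xi>_mono: "\<xi> x \<le> \<xi> y" if "0 < y" "y \<le> x" for x y
  proof (rule DERIV_nonpos_imp_nonincreasing[OF that(2)])
    fix z assume "y \<le> z"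
    then show "\<exists>d. (\<xi> has_real_derivative d) (at z) \<and> d \<le> 0"
      using r[of z] \<xi>[of z] that by (intro exI[of _ "- r z"]) auto
  qed
  have \<xi>_cont: "continuous_on {0<..} \<xi>"
    using \<xi> by (auto intro!: continuous_at_imp_continuous_on DERIV_isCont)

  have dom: "F integrable_on {0..x}" "norm (integral {0..x} F) \<le> C * (\<phi> x - 1)"
    if F: "continuous_on {0<..} F" and F0: "F 0 = 0"
      and le: "\<And>y. \<lbrakk>0 < y; y \<le> x\<rbrakk> \<Longrightarrow> norm (F y) \<le> C * (norm (q0 y) * \<phi> y)" and "x > 0"
    for F :: "real \<Rightarrow> complex" and C x
  proof -
    have i: "((\<lambda>y. C * (norm (q0 y) * \<phi> y)) has_integral C * (\<phi> x - 1)) {0..x}"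
      using \<phi>_int \<open>x > 0\<close> by (intro has_integral_mult_right) auto
    \<comment> \<open>At 0 both sides vanish, by \<open>F 0 = 0\<close> and
      \<open>q0 0 = 0\<close>.\<close>
    have le': "norm (F y) \<le> C * (norm (q0 y) * \<phi> y)" if "y \<in> {0..x}" for y
      using le[of y] that F0 by (cases "y = 0") (auto simp: q0_def)
    show "F integrable_on {0..x}" "norm (integral {0..x} F) \<le> C * (\<phi> x - 1)"
      using improper_integral_bound[OF F has_integral_integrable[OF i] le'] integral_unique[OF i] by auto
  qed

  \<comment> \<open>\<open>P\<close> is the Volterra operator with kernel \<open>(1 - exp (2 \<xi> x - 2 \<xi> y)) q y / 2\<close>, separated so that
    each factor depends on one variable.\<close>
  define X :: "(real \<Rightarrow> complex) set" where "X = {u. continuous_on {0<..} u \<and> (\<exists>M. \<forall>x>0. norm (u x) \<le> M * \<phi> x)}"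
  define A where "A u x = integral {0..x} (\<lambda>y. q0 y * u y)" for u x
  define B where "B u x = integral {0..x} (\<lambda>y. exp (- 2 * \<xi> y) * (q0 y * u y))" for u x
  define P where "P u x = 1 + A u x / 2 - exp (2 * \<xi> x) * B u x / 2" for u x

  \<comment> \<open>Estimates and derivatives of the two integral terms\<close>
  have contA: "continuous_on {0<..} (\<lambda>y. q0 y * u y)"
    and contB: "continuous_on {0<..} (\<lambda>y. exp (- 2 * \<xi> y) * (q0 y * u y))" if "u \<in> X" for u
    using that by (auto simp: X_def intro!: continuous_intros q0_cont \<xi>_cont)
  have le_exp: "norm (q0 y * u y) \<le> M * (norm (q0 y) * \<phi> y)"
    "norm (exp (- 2 * \<xi> y) * (q0 y * u y)) \<le> exp (- 2 * \<xi> x) * M * (norm (q0 y) * \<phi> y)"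
    if "\<forall>x>0. norm (u x) \<le> M * \<phi> x" "0 < y" "y \<le> x" for u :: "real \<Rightarrow> complex" and M x y
  proof -
    show 1: "norm (q0 y * u y) \<le> M * (norm (q0 y) * \<phi> y)"
      using mult_left_mono[of "norm (u y)" "M * \<phi> y" "norm (q0 y)"] that by (simp add: norm_mult mult_ac)
    \<comment> \<open>For \<open>y \<le> x\<close> monotonicity gives
      \<open>\<xi> x \<le> \<xi> y\<close>; the factor \<open>exp (- 2 * \<xi> x)\<close> obtained
      here is later cancelled by \<open>exp (2 * \<xi> x)\<close> in front of
      \<open>B\<close>.\<close>
    have "exp (- 2 * \<xi> y) * norm (q0 y * u y) \<le> exp (- 2 * \<xi> x) * (M * (norm (q0 y) * \<phi> y))"
      using \<xi>_mono[of y x] that 1 by (intro mult_mono) auto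
    then show "norm (exp (- 2 * \<xi> y) * (q0 y * u y)) \<le> exp (- 2 * \<xi> x) * M * (norm (q0 y) * \<phi> y)"
      by (simp add: norm_mult mult_ac)
  qed
  have intA: "(\<lambda>y. q0 y * u y) integrable_on {0..x}"
    and boundA: "norm (A u x) \<le> M * (\<phi> x - 1)"
    and intB: "(\<lambda>y. exp (- 2 * \<xi> y) * (q0 y * u y)) integrable_on {0..x}"
    and boundB: "norm (exp (2 * \<xi> x) * B u x) \<le> M * (\<phi> x - 1)"
    if u: "u \<in> X" and M: "\<forall>x>0. norm (u x) \<le> M * \<phi> x" and x: "x > 0" for u M x
  proof -
    show "(\<lambda>y. q0 y * u y) integrable_on {0..x}" "norm (A u x) \<le> M * (\<phi> x - 1)"
      using dom[OF contA[OF u] _ le_exp(1)[OF M]] x by (auto simp: A_def q0_def)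
    have *: "norm (B u x) \<le> exp (- 2 * \<xi> x) * M * (\<phi> x - 1)"
      unfolding B_def using x by (intro dom(2)[OF contB[OF u] _ le_exp(2)[OF M]]) (auto simp: q0_def)
    show "(\<lambda>y. exp (- 2 * \<xi> y) * (q0 y * u y)) integrable_on {0..x}"
      using dom(1)[OF contB[OF u] _ le_exp(2)[OF M]] x by (auto simp: q0_def)
    show "norm (exp (2 * \<xi> x) * B u x) \<le> M * (\<phi> x - 1)"
      using mult_left_mono[OF *, of "exp (2 * \<xi> x)"]
      by (simp add: norm_mult mult.assoc[symmetric] flip: exp_add)
  qed
  have all_int: "(\<lambda>y. q0 y * u y) integrable_on {0..x}"
    "(\<lambda>y. exp (- 2 * \<xi> y) * (q0 y * u y)) integrable_on {0..x}" if u: "u \<in> X" for u x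
  proof -
    obtain M where M: "\<forall>x>0. norm (u x) \<le> M * \<phi> x"
      using u by (auto simp: X_def)
    have "f integrable_on {0..x}" if "\<not> x > 0" for f :: "real \<Rightarrow> complex"
      using that integrable_on_refl[of f 0] by (cases "x = 0") auto
    then show "(\<lambda>y. q0 y * u y) integrable_on {0..x}"
      "(\<lambda>y. exp (- 2 * \<xi> y) * (q0 y * u y)) integrable_on {0..x}"
      using intA[OF u M] intB[OF u M] by blast+
  qed
  have derivA: "(A u has_vector_derivative q x * u x) (at x)"
    and derivB: "(B u has_vector_derivative exp (- 2 * \<xi> x) * (q x * u x)) (at x)"
    if "u \<in> X" "x > 0" for u x
    using improper_integral_has_vector_derivative[OF contA[OF that(1)] all_int(1)[OF that(1)] that(2)]
      improper_integral_has_vector_derivative[OF contB[OF that(1)] all_int(2)[OF that(1)] that(2)]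
    unfolding A_def B_def using that by (auto simp: q0_def)
  have A_cont: "continuous_on {0<..} (A u)" "continuous_on {0<..} (B u)" if "u \<in> X" for u
    using derivA[OF that] derivB[OF that]
    by (auto intro!: continuous_at_imp_continuous_on has_vector_derivative_continuous)

  \<comment> \<open>The contraction property and the fixed point\<close>
  have "\<exists>u\<in>X. \<forall>x>0. u x = P u x"
    unfolding X_def
  \<comment> \<open>\<open>C = 1\<close> suits because \<open>P\<close> maps the zero function to
    the constant 1 and \<open>\<phi> \<ge> 1\<close>.\<close>
  proof (rule weighted_fixed_point[where C = 1], unfold X_def[symmetric])
    fix u assume "u \<in> X"
    then show "continuous_on {0<..} (P u)"
      unfolding P_def by (intro continuous_intros A_cont \<xi>_cont) auto
  next
    fix u v M and x :: real
    assume u: "u \<in> X" and v: "v \<in> X" and le: "\<forall>y>0. norm (u y - v y) \<le> M * \<phi> y" and x: "x > 0"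
    have M: "M \<ge> 0"
      using le[rule_format, OF x] \<phi>(3)[of x] norm_ge_zero[of "u x - v x"]
      by (smt (verit) mult_neg_pos)
    \<comment> \<open>The two integrals are recombined into one kernel: bounding them separately
      would give the contraction constant 1 instead of 1/2.\<close>
    define K where "K y = of_real (1 - exp (2 * \<xi> x - 2 * \<xi> y)) * (q0 y * (u y - v y))" for y
    have "A u x - A v x = integral {0..x} (\<lambda>y. q0 y * u y - q0 y * v y)"
      unfolding A_def by (intro Henstock_Kurzweil_Integration.integral_diff[symmetric] all_int u v)
    moreover have "exp (2 * \<xi> x) * (B u x - B v x) = integral {0..x} (\<lambda>y. exp (2 * \<xi> x) *
        (exp (- 2 * \<xi> y) * (q0 y * u y) - exp (- 2 * \<xi> y) * (q0 y * v y)))"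
      unfolding B_def integral_mult_right
        by (simp only: Henstock_Kurzweil_Integration.integral_diff[OF all_int(2)[OF u] all_int(2)[OF v]])
    ultimately have "A u x - A v x - exp (2 * \<xi> x) * (B u x - B v x) = integral {0..x} (\<lambda>y.
        (q0 y * u y - q0 y * v y) - exp (2 * \<xi> x) *
        (exp (- 2 * \<xi> y) * (q0 y * u y) - exp (- 2 * \<xi> y) * (q0 y * v y)))"
      by (simp only: Henstock_Kurzweil_Integration.integral_diff[OF
            integrable_diff[OF all_int(1)[OF u] all_int(1)[OF v]]
            integrable_on_mult_right[OF integrable_diff[OF all_int(2)[OF u] all_int(2)[OF v]]]])
    also have "\<dots> = integral {0..x} K"
    proof (rule integral_cong)
      fix y
      have "of_real (exp (2 * \<xi> x - 2 * \<xi> y)) = complex_of_real (exp (2 * \<xi> x)) * of_real (exp (- 2 * \<xi> y))"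
        by (simp add: exp_diff exp_minus divide_inverse)
      then show "(q0 y * u y - q0 y * v y) - exp (2 * \<xi> x) *
        (exp (- 2 * \<xi> y) * (q0 y * u y) - exp (- 2 * \<xi> y) * (q0 y * v y)) = K y"
        unfolding K_def of_real_diff of_real_1 by (simp only: algebra_simps mult_1_left)
    qed
    finally have "A u x - A v x - exp (2 * \<xi> x) * (B u x - B v x) = integral {0..x} K" .
    moreover have "P u x - P v x = (A u x - A v x - exp (2 * \<xi> x) * (B u x - B v x)) / 2"
      unfolding P_def by (simp add: diff_divide_distrib right_diff_distrib)
    ultimately have "P u x - P v x = integral {0..x} K / 2"
      by simp
    then have "norm (P u x - P v x) = norm (integral {0..x} K) / 2"
      by (simp only: norm_divide) simp
    moreover have "norm (integral {0..x} K) \<le> M * (\<phi> x - 1)"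
    proof (rule dom)
      show "continuous_on {0<..} K"
        unfolding K_def using u v by (intro continuous_intros \<xi>_cont q0_cont) (auto simp: X_def)
      fix y assume y: "0 < y" "y \<le> x"
      \<comment> \<open>The exponent is nonpositive for \<open>y \<le> x\<close>, so the kernel lies
        between 0 and 1.\<close>
      have "\<bar>1 - exp (2 * \<xi> x - 2 * \<xi> y)\<bar> \<le> 1"
        using \<xi>_mono[OF y] by (simp add: abs_le_iff order_trans[OF _ exp_ge_zero])
      then have "\<bar>1 - exp (2 * \<xi> x - 2 * \<xi> y)\<bar> * norm (q0 y * (u y - v y)) \<le> 1 * (norm (q0 y) * (M * \<phi> y))"
        using le y unfolding norm_mult[of "q0 y"] by (intro mult_mono mult_left_mono) auto
      moreover have "norm (K y) = \<bar>1 - exp (2 * \<xi> x - 2 * \<xi> y)\<bar> * norm (q0 y * (u y - v y))"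
        unfolding K_def by (simp only: norm_mult norm_of_real)
      ultimately show "norm (K y) \<le> M * (norm (q0 y) * \<phi> y)"
        by (simp add: mult_ac)
    qed (use x in \<open>auto simp: K_def q0_def\<close>)
    ultimately show "norm (P u x - P v x) \<le> M / 2 * \<phi> x"
      using M by (simp add: right_diff_distrib)
  qed (use \<phi> \<phi>_cont in \<open>auto simp: P_def A_def B_def\<close>)
  then obtain w where w: "w \<in> X" and fix_w: "\<And>x. x > 0 \<Longrightarrow> w x = P w x"
    by auto
  then obtain M where M: "\<forall>x>0. norm (w x) \<le> M * \<phi> x"
    by (auto simp: X_def)

  \<comment> \<open>From the fixed point to the system and its limits\<close>
  define a where "a x = 1 + A w x / 2" for x
  define b where "b x = exp (2 * \<xi> x) * B w x / 2" for x
  \<comment> \<open>Thus \<open>exp \<xi> * v = a - b = w\<close> on the half-line and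
    \<open>exp \<xi> * p = a + b\<close>.\<close>
  define v where "v x = exp (- \<xi> x) * (a x - b x)" for x
  define p where "p x = exp (- \<xi> x) * (a x + b x)" for x
  have w_eq: "w x = a x - b x" if "x > 0" for x
    using fix_w[OF that] by (simp add: P_def a_def b_def)
  have a': "(a has_vector_derivative q x * w x / 2) (at x)" if "x > 0" for x
    unfolding a_def by (auto intro!: derivative_eq_intros derivA w that)
  have e': "((\<lambda>x. complex_of_real (exp (c * \<xi> x))) has_vector_derivative - c * r x * exp (c * \<xi> x)) (at x)"
    if "x > 0" for x c
    using \<xi>[OF that] by (intro has_vector_derivative_of_real)
      (auto intro!: derivative_eq_intros simp: has_real_derivative_iff_has_vector_derivative[symmetric])
  have b': "(b has_vector_derivative - 2 * r x * b x + q x * w x / 2) (at x)" if "x > 0" for x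
  proof -
    have "complex_of_real (exp (2 * \<xi> x)) * exp (- 2 * \<xi> x) = 1"
      by (simp flip: of_real_mult exp_add)
    then have "complex_of_real (exp (2 * \<xi> x)) * (complex_of_real (exp (- 2 * \<xi> x)) * z) = z" for z
      by (metis mult.assoc mult_1)
    then have "(of_real (exp (2 * \<xi> x)) * (of_real (exp (- 2 * \<xi> x)) * (q x * w x)) +
        of_real (- 2 * r x * exp (2 * \<xi> x)) * B w x) / 2 = - 2 * r x * b x + q x * w x / 2"
      unfolding b_def by (simp only:) (simp add: field_simps)
    then show ?thesis
      using has_vector_derivative_divide[OF has_vector_derivative_mult[OF e'[OF that, of 2] derivB[OF w that]], of 2]
      unfolding b_def[abs_def] by metis
  qed
  note e1 = e'[of _ "-1", simplified]
  \<comment> \<open>In \<open>a - b\<close> the two terms with \<open>q\<close> cancel and leave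
    \<open>2 * r * b\<close>, which turns \<open>a - b\<close> into \<open>a + b\<close>. In
    \<open>a + b\<close> they add up to \<open>q * w\<close>.\<close>
  have "(v has_vector_derivative r x *\<^sub>R p x) (at x)" if "x > 0" for x
    using has_vector_derivative_mult[OF e1[OF that] has_vector_derivative_diff[OF a'[OF that] b'[OF that]]]
    unfolding v_def[abs_def] p_def by (simp add: algebra_simps scaleR_conv_of_real)
  moreover have "(p has_vector_derivative (r x + q x) * v x) (at x)" if "x > 0" for x
  proof -
    have eq: "q x * w x / 2 + (- 2 * r x * b x + q x * w x / 2) = q x * (a x - b x) - 2 * r x * b x"
      unfolding w_eq[OF that] by (simp add: field_simps)
    have "((\<lambda>x. a x + b x) has_vector_derivative q x * (a x - b x) - 2 * r x * b x) (at x)"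
      using has_vector_derivative_add[OF a'[OF that] b'[OF that]] unfolding eq .
    from has_vector_derivative_mult[OF e1[OF that] this]
    show ?thesis
      unfolding v_def p_def[abs_def] by (simp add: algebra_simps)
  qed
  moreover have "(a \<longlongrightarrow> 1) (at_right 0)" "(b \<longlongrightarrow> 0) (at_right 0)"
  proof -
    \<comment> \<open>Both integral terms are bounded by this expression, which vanishes at 0
      because \<open>\<phi>\<close> tends to 1.\<close>
    have lim: "((\<lambda>x. M * (\<phi> x - 1)) \<longlongrightarrow> 0) (at_right 0)"
      by (rule tendsto_eq_intros \<phi>_lim refl | simp)+
    have "(A w \<longlongrightarrow> 0) (at_right 0)" "((\<lambda>x. exp (2 * \<xi> x) * B w x) \<longlongrightarrow> 0) (at_right 0)"
      using boundA[OF w M] boundB[OF w M]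
      by (auto intro!: Lim_null_comparison[OF _ lim] simp: eventually_at_filter)
    from this[THEN tendsto_divide_zero, of 2]
    show "(a \<longlongrightarrow> 1) (at_right 0)" "(b \<longlongrightarrow> 0) (at_right 0)"
      unfolding a_def[abs_def] b_def[abs_def]
      using tendsto_add[OF tendsto_const[of "1::complex"]] by fastforce+
  qed
  then have "((\<lambda>x. a x - b x) \<longlongrightarrow> 1) (at_right 0)" "((\<lambda>x. a x + b x) \<longlongrightarrow> 1) (at_right 0)"
    by (auto intro!: tendsto_eq_intros)
  moreover have "exp (\<xi> x) * v x = a x - b x" "exp (\<xi> x) * p x = a x + b x" for x
    by (simp_all add: v_def p_def exp_minus)
  ultimately show ?thesis
    by (intro exI[of _ v] exI[of _ p]) auto
qed

section \<open>The dominant solution\<close>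

text \<open>A form of l'Hospital's rule: the mean value inequality bounds increments of
  \<open>D\<close> by a small multiple of increments of \<open>E\<close>. The additive constant
  allows for bounded \<open>E\<close>, where \<open>D\<close> itself need not tend to 0.\<close>

lemma asymptotic_of_derivative:
  fixes E e :: "real \<Rightarrow> real" and D \<epsilon> :: "real \<Rightarrow> complex"
  assumes E': "\<And>x. \<lbrakk>0 < x; x < \<delta>\<rbrakk> \<Longrightarrow> (E has_real_derivative - e x) (at x)"
    and e: "\<And>x. \<lbrakk>0 < x; x < \<delta>\<rbrakk> \<Longrightarrow> e x \<ge> 0"
    and D': "\<And>x. \<lbrakk>0 < x; x < \<delta>\<rbrakk> \<Longrightarrow> (D has_vector_derivative of_real (e x) * \<epsilon> x) (at x)"
    and \<epsilon>: "(\<epsilon> \<longlongrightarrow> 0) (at_right 0)" and E: "\<And>x. \<lbrakk>0 < x; x < \<delta>\<rbrakk> \<Longrightarrow> E x > 0" and "\<delta> > 0"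
  shows "\<exists>c. ((\<lambda>x. (D x + c) / E x) \<longlongrightarrow> 0) (at_right 0)"
proof -
  have antimono: "E y \<le> E x" if "0 < x" "x \<le> y" "y < \<delta>" for x y
  proof (rule DERIV_nonpos_imp_nonincreasing[OF that(2)])
    fix z assume "x \<le> z" "z \<le> y"
    then show "\<exists>d. (E has_real_derivative d) (at z) \<and> d \<le> 0"
      using E'[of z] e[of z] that by (intro exI[of _ "- e z"]) auto
  qed
  have D_le: "norm (D y - D x) \<le> C * (E x - E y)"
    if "0 < x" "x \<le> y" "y < \<delta>" and C: "\<And>z. \<lbrakk>0 < z; z < y\<rbrakk> \<Longrightarrow> norm (\<epsilon> z) \<le> C" for x y C
  proof (cases "x = y")
    case False
    have "norm (D y - D x) \<le> - C * E y - (- C * E x)"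
    proof (rule differentiable_bound_general[where f' = "\<lambda>z. of_real (e z) * \<epsilon> z" and \<phi>' = "\<lambda>z. C * e z"])
      show "continuous_on {x..y} D"
        using that by (auto intro!: continuous_at_imp_continuous_on has_vector_derivative_continuous[OF D'])
      show "continuous_on {x..y} (\<lambda>z. - C * E z)"
        using that by (auto intro!: continuous_intros continuous_at_imp_continuous_on DERIV_isCont[OF E'])
      fix z assume z: "x < z" "z < y"
      then show "(D has_vector_derivative of_real (e z) * \<epsilon> z) (at z)"
        using that by (intro D') auto
      have "((\<lambda>z. - C * E z) has_real_derivative C * e z) (at z)"
        using E'[of z] z that by (auto intro!: derivative_eq_intros)
      then show "((\<lambda>z. - C * E z) has_vector_derivative C * e z) (at z)"
        by (simp add: has_real_derivative_iff_has_vector_derivative)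
      show "norm (of_real (e z) * \<epsilon> z) \<le> C * e z"
        using mult_right_mono[OF C[of z] e[of z]] e[of z] z that by (simp add: norm_mult mult.commute)
    qed (use that False in auto)
    then show ?thesis by (simp add: algebra_simps)
  qed auto
  have small: "\<exists>d. 0 < d \<and> d < \<delta> \<and> (\<forall>z. 0 < z \<and> z < d \<longrightarrow> norm (\<epsilon> z) \<le> C)" if "C > 0" for C
  proof -
    have "\<forall>\<^sub>F z in at_right 0. norm (\<epsilon> z) < C"
      using \<epsilon> that by (auto simp: tendsto_iff)
    then obtain b where "b > 0" "\<And>z. \<lbrakk>0 < z; z < b\<rbrakk> \<Longrightarrow> norm (\<epsilon> z) < C"
      unfolding eventually_at_right_field by auto
    then show ?thesis
      using \<open>\<delta> > 0\<close> by (intro exI[of _ "min b (\<delta> / 2)"]) (auto simp: less_imp_le)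
  qed
  \<comment> \<open>If \<open>E\<close> is bounded then \<open>D\<close> converges; otherwise \<open>E\<close> tends to infinity and any \<open>c\<close> works.\<close>
  show ?thesis
  proof (cases "bdd_above (E ` {0<..<\<delta>})")
    case True
    obtain d where d: "0 < d" "d < \<delta>" "\<And>z. \<lbrakk>0 < z; z < d\<rbrakk> \<Longrightarrow> norm (\<epsilon> z) \<le> 1"
      using small[OF zero_less_one] by blast
    \<comment> \<open>\<open>E\<close> is monotone and bounded, so close to 0 it stays within
      \<open>\<eta>\<close> of its supremum; increments of \<open>E\<close> dominate those of
      \<open>D\<close>.\<close>
    have "cauchy_filter (filtermap D (at_right 0))"
      unfolding cauchy_filter_metric_filtermap
    proof (intro allI impI)
      fix \<eta> :: real assume "\<eta> > 0"
      let ?s = "Sup (E ` {0<..<\<delta>})"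
      have "?s - \<eta> < ?s" "{0<..<\<delta>} \<noteq> {}"
        using \<open>\<eta> > 0\<close> \<open>\<delta> > 0\<close> by auto
      then obtain y where y: "0 < y" "y < \<delta>" "?s - \<eta> < E y"
        using less_cSup_iff[of "E ` {0<..<\<delta>}" "?s - \<eta>"] True by auto
      have *: "norm (D x' - D x) < \<eta>" if "0 < x" "x \<le> x'" "x' < y" "x' < d" for x x'
      proof -
        have "E x \<le> ?s"
          using that y by (intro cSup_upper True) auto
        moreover have "E y \<le> E x'"
          using that y by (intro antimono) auto
        moreover have "norm (D x' - D x) \<le> 1 * (E x - E x')"
          using that y d by (intro D_le) auto
        ultimately show ?thesis using y by simp
      qed
      have "dist (D x) (D x') < \<eta>" if "0 < x" "x < y" "x < d" "0 < x'" "x' < y" "x' < d" for x x'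
        using *[of x x'] *[of x' x] that by (cases "x \<le> x'") (auto simp: dist_norm norm_minus_commute)
      moreover have "\<forall>\<^sub>F x in at_right 0. 0 < x \<and> x < y \<and> x < d"
        using y d unfolding eventually_at_right_field by (intro exI[of _ "min y d"]) auto
      ultimately show "\<exists>P. eventually P (at_right 0) \<and> (\<forall>x y. P x \<and> P y \<longrightarrow> dist (D x) (D y) < \<eta>)"
        by blast
    qed
    then obtain l where l: "(D \<longlongrightarrow> l) (at_right 0)"
      using cauchy_filter_convergent unfolding convergent_filter_iff filterlim_def by metis
    have "((\<lambda>x. norm (D x - l) / E (\<delta> / 2)) \<longlongrightarrow> 0) (at_right 0)"
      using tendsto_norm_zero[OF LIM_zero[OF l]] by (rule tendsto_divide_zero)
    \<comment> \<open>\<open>E\<close> increases towards 0, so its positive value at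
      \<open>\<delta> / 2\<close> bounds the denominators from below.\<close>
    moreover have "norm ((D x + - l) / E x) \<le> norm (D x - l) / E (\<delta> / 2)" if "0 < x" "x < \<delta> / 2" for x
      using that antimono[of x "\<delta> / 2"] E[of x] E[of "\<delta> / 2"] \<open>\<delta> > 0\<close>
      by (simp add: norm_divide frac_le)
    then have "\<forall>\<^sub>F x in at_right 0. norm ((D x + - l) / E x) \<le> norm (D x - l) / E (\<delta> / 2)"
      using \<open>\<delta> > 0\<close> unfolding eventually_at_right_field by (intro exI[of _ "\<delta> / 2"]) auto
    ultimately show ?thesis
      by (intro exI[of _ "- l"]) (rule Lim_null_comparison)
  next
    case False
    have "((\<lambda>x. D x / E x) \<longlongrightarrow> 0) (at_right 0)"
      unfolding tendsto_iff
    proof (intro allI impI)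
      fix \<eta> :: real assume "\<eta> > 0"
      then obtain d where d: "0 < d" "d < \<delta>" "\<And>z. \<lbrakk>0 < z; z < d\<rbrakk> \<Longrightarrow> norm (\<epsilon> z) \<le> \<eta> / 2"
        using small[OF half_gt_zero] by blast
      \<comment> \<open>\<open>E\<close> beyond this threshold absorbs the constant
        \<open>norm (D d)\<close> into \<open>\<eta> / 2 * E x\<close>.\<close>
      obtain y where y: "0 < y" "y < \<delta>" "2 * norm (D d) / \<eta> < E y"
        using False unfolding bdd_above_def by (force simp: not_le)
      have "norm (D x) / E x < \<eta>" if x: "0 < x" "x < y" "x < d" for x
      proof -
        have "norm (D x) \<le> norm (D d) + \<eta> / 2 * (E x - E d)"
          using D_le[of x d "\<eta> / 2"] d x norm_triangle_sub[of "D x" "D d"]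
          by (simp add: norm_minus_commute)
        also have "\<dots> < \<eta> / 2 * E x + \<eta> / 2 * E x"
        proof -
          have "2 * norm (D d) / \<eta> < E x"
            using y antimono[of x y] x by simp
          then have "norm (D d) < \<eta> / 2 * E x"
            using \<open>\<eta> > 0\<close> by (simp add: field_simps)
          moreover have "\<eta> / 2 * (E x - E d) \<le> \<eta> / 2 * E x"
            using E[of d] d \<open>\<eta> > 0\<close> by (intro mult_left_mono) auto
          ultimately show ?thesis by simp
        qed
        finally show ?thesis
          using E[of x] x y by (simp add: field_simps)
      qed
      then have "dist (D x / E x) 0 < \<eta>" if "0 < x" "x < min y d" for x
        using that E[of x] y by (simp add: norm_divide)
      then show "\<forall>\<^sub>F x in at_right 0. dist (D x / E x) 0 < \<eta>"
        using y d unfolding eventually_at_right_field by (intro exI[of _ "min y d"]) auto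
    qed
    then show ?thesis by (intro exI[of _ 0]) simp
  qed
qed

text \<open>The quotient \<open>y / v + c\<close> is compared with \<open>exp (2 * \<xi>)\<close>
  through their derivatives. The limit for the second component follows from the Wronskian, which
  gives \<open>z + c * p = p * (y / v + c) - 2 / v\<close>, hence the value
  \<open>1 - 2 = -1\<close>.\<close>

lemma dominant_solution:
  fixes r \<xi> :: "real \<Rightarrow> real" and v p y z :: "real \<Rightarrow> complex"
  assumes r: "\<And>x. x > 0 \<Longrightarrow> r x \<ge> 0"
    and \<xi>: "\<And>x. x > 0 \<Longrightarrow> (\<xi> has_real_derivative - r x) (at x)"
    and v': "\<And>x. x > 0 \<Longrightarrow> (v has_vector_derivative r x *\<^sub>R p x) (at x)"
    and y': "\<And>x. x > 0 \<Longrightarrow> (y has_vector_derivative r x *\<^sub>R z x) (at x)"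
    and wronskian: "\<And>x. x > 0 \<Longrightarrow> v x * z x - p x * y x = -2"
    and v: "((\<lambda>x. exp (\<xi> x) * v x) \<longlongrightarrow> 1) (at_right 0)"
    and p: "((\<lambda>x. exp (\<xi> x) * p x) \<longlongrightarrow> 1) (at_right 0)"
  shows "\<exists>c. ((\<lambda>x. exp (- \<xi> x) * (y x + c * v x)) \<longlongrightarrow> 1) (at_right 0) \<and>
    ((\<lambda>x. exp (- \<xi> x) * (z x + c * p x)) \<longlongrightarrow> -1) (at_right 0)"
proof -
  define E where "E x = exp (2 * \<xi> x)" for x
  have E2: "(exp (\<xi> x) * v x)\<^sup>2 = E x * (v x * v x)" for x
  proof -
    have "exp (\<xi> x) * exp (\<xi> x) = E x"
      by (simp add: E_def flip: exp_add)
    then have "complex_of_real (exp (\<xi> x)) * of_real (exp (\<xi> x)) = of_real (E x)"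
      by (metis of_real_mult)
    then show ?thesis
      by (simp add: power2_eq_square mult_ac)
  qed
  \<comment> \<open>\<open>\<epsilon>\<close> is the relative defect:
    \<open>(y / v - E)' = 2 * r * E * \<epsilon>\<close>, and it vanishes at 0 because
    \<open>exp \<xi> * v\<close> tends to 1.\<close>
  define \<epsilon> where "\<epsilon> x = 1 - 1 / (exp (\<xi> x) * v x)\<^sup>2" for x
  have "\<forall>\<^sub>F x in at_right 0. exp (\<xi> x) * v x \<noteq> 0"
    using v by (rule tendsto_imp_eventually_ne) simp
  then obtain \<delta> where \<delta>: "\<delta> > 0" "\<And>x. \<lbrakk>0 < x; x < \<delta>\<rbrakk> \<Longrightarrow> v x \<noteq> 0"
    unfolding eventually_at_right_field by auto
  have "\<exists>c. ((\<lambda>x. (y x / v x - E x + c) / E x) \<longlongrightarrow> 0) (at_right 0)"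
  proof (rule asymptotic_of_derivative[where e = "\<lambda>x. 2 * r x * E x" and \<epsilon> = \<epsilon> and \<delta> = \<delta>])
    have "(\<epsilon> \<longlongrightarrow> 1 - 1 / 1\<^sup>2) (at_right 0)"
      unfolding \<epsilon>_def by (intro tendsto_intros v) simp
    then show "(\<epsilon> \<longlongrightarrow> 0) (at_right 0)" by simp
    fix x assume x: "0 < x" "x < \<delta>"
    show E': "(E has_real_derivative - (2 * r x * E x)) (at x)"
      unfolding E_def using \<xi>[of x] x by (auto intro!: derivative_eq_intros)
    have v0: "v x \<noteq> 0" using \<delta> x by auto
    have "((\<lambda>x. y x / v x) has_vector_derivative
        (r x *\<^sub>R z x * v x - y x * (r x *\<^sub>R p x)) / (v x * v x)) (at x)"
      using has_derivative_divide'[OF y'[of x, unfolded has_vector_derivative_def]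
          v'[of x, unfolded has_vector_derivative_def] v0] x
      by (auto simp: has_vector_derivative_def scaleR_conv_of_real algebra_simps diff_divide_distrib)
    moreover have "r x *\<^sub>R z x * v x - y x * (r x *\<^sub>R p x) = -2 * r x"
      using arg_cong[OF wronskian[of x], of "\<lambda>w. r x *\<^sub>R w"] x
      by (simp add: algebra_simps scaleR_conv_of_real)
    moreover have "((\<lambda>x. complex_of_real (E x)) has_vector_derivative of_real (- (2 * r x * E x))) (at x)"
      using E' by (intro has_vector_derivative_of_real)
    ultimately have "((\<lambda>x. y x / v x - E x) has_vector_derivative
        -2 * r x / (v x * v x) - of_real (- (2 * r x * E x))) (at x)"
      by (intro has_vector_derivative_diff) simp_all
    moreover have "complex_of_real (E x) \<noteq> 0"
      by (simp add: E_def)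
    then have "-2 * r x / (v x * v x) - of_real (- (2 * r x * E x)) = of_real (2 * r x * E x) * \<epsilon> x"
      unfolding \<epsilon>_def E2 using v0 by (simp add: field_simps)
    ultimately show "((\<lambda>x. y x / v x - E x) has_vector_derivative of_real (2 * r x * E x) * \<epsilon> x) (at x)"
      by simp
  qed (use r \<delta> in \<open>auto simp: E_def\<close>)
  then obtain c where c: "((\<lambda>x. (y x / v x - E x + c) / E x) \<longlongrightarrow> 0) (at_right 0)"
    by blast
  \<comment> \<open>This is \<open>(y / v + c) / E\<close>, written so that its limit 1 is immediate
    from the choice of \<open>c\<close>.\<close>
  define Q where "Q x = (y x / v x - E x + c) / E x + 1" for x
  have Q: "(Q \<longlongrightarrow> 1) (at_right 0)"
    unfolding Q_def using tendsto_add[OF c tendsto_const[of 1]] by simp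
  have near: "\<forall>\<^sub>F x in at_right 0. 0 < x \<and> v x \<noteq> 0"
    using \<delta> unfolding eventually_at_right_field by blast
  have id: "exp (- \<xi> x) * (y x + c * v x) = exp (\<xi> x) * v x * Q x"
    "exp (- \<xi> x) * (z x + c * p x) = exp (\<xi> x) * p x * Q x - 2 / (exp (\<xi> x) * v x)"
    if "0 < x" "v x \<noteq> 0" for x
  proof -
    define e where "e = complex_of_real (exp (\<xi> x))"
    have e: "e \<noteq> 0" "complex_of_real (exp (- \<xi> x)) = 1 / e"
      by (auto simp: e_def exp_minus field_simps)
    have z: "z x = (p x * y x - 2) / v x"
      using wronskian[of x] that by (simp add: field_simps)
    have "complex_of_real (E x) = e * e"
      unfolding e_def E_def by (simp flip: of_real_mult exp_add)
    then have Q: "Q x = (y x / v x + c) / (e * e)"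
      unfolding Q_def using e(1) by (simp add: field_simps)
    show "exp (- \<xi> x) * (y x + c * v x) = exp (\<xi> x) * v x * Q x"
      "exp (- \<xi> x) * (z x + c * p x) = exp (\<xi> x) * p x * Q x - 2 / (exp (\<xi> x) * v x)"
      unfolding e(2) e_def[symmetric] Q z using that(2) e(1) by (simp_all add: field_simps)
  qed
  have "((\<lambda>x. exp (\<xi> x) * v x * Q x) \<longlongrightarrow> 1 * 1) (at_right 0)"
    "((\<lambda>x. exp (\<xi> x) * p x * Q x - 2 / (exp (\<xi> x) * v x)) \<longlongrightarrow> 1 * 1 - 2 / 1) (at_right 0)"
    by (intro tendsto_intros v p Q; simp)+
  then have lim: "((\<lambda>x. exp (\<xi> x) * v x * Q x) \<longlongrightarrow> 1) (at_right 0)"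
    "((\<lambda>x. exp (\<xi> x) * p x * Q x - 2 / (exp (\<xi> x) * v x)) \<longlongrightarrow> -1) (at_right 0)"
    by simp_all
  have "((\<lambda>x. exp (- \<xi> x) * (y x + c * v x)) \<longlongrightarrow> 1) (at_right 0)"
    by (rule Lim_transform_eventually[OF lim(1) eventually_mono[OF near]]) (use id in metis)
  moreover have "((\<lambda>x. exp (- \<xi> x) * (z x + c * p x)) \<longlongrightarrow> -1) (at_right 0)"
    by (rule Lim_transform_eventually[OF lim(2) eventually_mono[OF near]]) (use id in metis)
  ultimately show ?thesis by blast
qed

section \<open>The Liouville-Green transformation\<close>

lemma second_deriv_eqI:
  assumes "open I" "x \<in> I" and u: "\<And>y. y \<in> I \<Longrightarrow> (u has_vector_derivative u' y) (at y)"
    and u': "(u' has_vector_derivative w) (at x)"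
  shows "second_deriv u x = w"
proof -
  have "((\<lambda>y. vector_derivative u (at y)) has_vector_derivative w) (at x)"
    by (rule has_vector_derivative_transform_within_open[OF u' assms(1,2)])
      (simp add: vector_derivative_at[OF u])
  then show ?thesis
    unfolding second_deriv_def by (rule vector_derivative_at)
qed

lemma has_vector_derivative_powr:
  fixes f :: "real \<Rightarrow> real"
  assumes "(f has_vector_derivative f') (at x)" "f x > 0"
  shows "((\<lambda>x. f x powr a) has_vector_derivative a * f x powr (a - 1) * f') (at x)"
  using DERIV_powr[of f f' x "\<lambda>_. a" 0] DERIV_fun_powr[of f f' x a] assms
  by (auto simp: has_real_derivative_iff_has_vector_derivative)

text \<open>With \<open>h = f powr (-1/4)\<close>, \<open>k = f powr (1/4)\<close>,
  \<open>r = f powr (1/2)\<close> and \<open>u = h * v\<close>, one gets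
  \<open>u' = h' * v + k * p\<close>. Since \<open>k' = - h' * r\<close>, the terms with
  \<open>p\<close> cancel in \<open>u''\<close>; then \<open>k * r = f * h\<close> and
  \<open>k * psi = - h'' + g * h\<close> leave \<open>(f + g) * u\<close>.\<close>

lemma liouville_transform:
  fixes f :: "real \<Rightarrow> real" and g :: "real \<Rightarrow> complex"
  assumes f: "C2_on {0<..} f" "\<And>x. x > 0 \<Longrightarrow> f x > 0" and g: "continuous_on {0<..} g"
  shows continuous_on_psi: "continuous_on {0<..} (psi f g)"
    and is_solution_of_system:
      "\<lbrakk>\<And>x. x > 0 \<Longrightarrow> (v has_vector_derivative f x powr (1/2) *\<^sub>R p x) (at x);
        \<And>x. x > 0 \<Longrightarrow> (p has_vector_derivative (f x powr (1/2) + psi f g x) * v x) (at x)\<rbrakk>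
       \<Longrightarrow> is_solution f g (\<lambda>x. of_real (f x powr (-1/4)) * v x)"
proof -
  obtain f1 f2 where f1: "\<And>x. x > 0 \<Longrightarrow> (f has_vector_derivative f1 x) (at x)"
    and f2: "\<And>x. x > 0 \<Longrightarrow> (f1 has_vector_derivative f2 x) (at x)" and f2_cont: "continuous_on {0<..} f2"
    using f(1) unfolding C2_on_def by auto
  have f_cont: "continuous_on {0<..} f" "continuous_on {0<..} f1"
    using f1 f2 by (auto intro!: continuous_at_imp_continuous_on has_vector_derivative_continuous)
  define h where "h x = f x powr (-1/4)" for x
  define h1 where "h1 x = - (1/4) * f x powr (-5/4) * f1 x" for x
  define h2 where "h2 x = 5/16 * f x powr (-9/4) * (f1 x)\<^sup>2 - 1/4 * f x powr (-5/4) * f2 x" for x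
  have h1: "(h has_vector_derivative h1 x) (at x)" and h2: "(h1 has_vector_derivative h2 x) (at x)"
    if "x > 0" for x
  proof -
    note pw = has_vector_derivative_powr[OF f1 f(2), OF that that]
    show "(h has_vector_derivative h1 x) (at x)"
      using pw[of "-1/4"] by (simp add: h_def[abs_def] h1_def)
    show "(h1 has_vector_derivative h2 x) (at x)"
      unfolding h1_def[abs_def] h2_def
      using has_vector_derivative_mult[OF has_vector_derivative_mult[OF
          has_vector_derivative_const[of "-(1/4)"] pw[of "-5/4"]] f2[OF that]]
      by (simp add: power2_eq_square mult_ac)
  qed
  have h_cont: "continuous_on {0<..} h" "continuous_on {0<..} h2"
    unfolding h_def h2_def by (auto intro!: continuous_intros f_cont f2_cont dest: f(2))
  have psi_eq: "psi f g x = h x * (- of_real (h2 x) + g x * h x)" if "x > 0" for x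
  proof -
    \<comment> \<open>Near a positive point \<open>|f|\<close> is \<open>f\<close>, which makes the
      \<open>second_deriv\<close> inside \<open>psi\<close> the explicit \<open>h2\<close>.\<close>
    have "((\<lambda>y. \<bar>f y\<bar> powr (-1/4)) has_vector_derivative h1 y) (at y)" if "y > 0" for y
      by (rule has_vector_derivative_transform_within_open[OF h1[OF that], of "{0<..}"])
        (use that f(2) in \<open>simp_all add: h_def abs_of_pos\<close>)
    then have "second_deriv (\<lambda>y. \<bar>f y\<bar> powr (-1/4)) x = h2 x"
      using that by (intro second_deriv_eqI[of "{0<..}", OF _ _ _ h2]) auto
    then show ?thesis
      using f(2)[OF that] by (simp add: psi_def h_def)
  qed
  have "continuous_on {0<..} (\<lambda>x. h x * (- of_real (h2 x) + g x * h x))"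
    by (intro continuous_intros h_cont g)
  then show "continuous_on {0<..} (psi f g)"
    by (rule continuous_on_eq) (simp add: psi_eq)

  assume v: "\<And>x. x > 0 \<Longrightarrow> (v has_vector_derivative f x powr (1/2) *\<^sub>R p x) (at x)"
    and p: "\<And>x. x > 0 \<Longrightarrow> (p has_vector_derivative (f x powr (1/2) + psi f g x) * v x) (at x)"
  define k where "k x = f x powr (1/4)" for x
  define u where "u x = of_real (h x) * v x" for x
  define u1 where "u1 x = of_real (h1 x) * v x + of_real (k x) * p x" for x
  have u1: "(u has_vector_derivative u1 x) (at x)"
    and u2: "(u1 has_vector_derivative (of_real (f x) + g x) * u x) (at x)" if x: "x > 0" for x
  proof -
    define r where "r = f x powr (1/2)"
    \<comment> \<open>The exponents of \<open>f\<close> add up; the right side of the second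
      identity is the derivative of \<open>k\<close> with opposite sign.\<close>
    have alg: "h x * r = k x" "h1 x * r = - (1/4 * f x powr (-3/4) * f1 x)" "k x * r = f x * h x" "k x * h x = 1"
      using f(2)[OF x] by (auto simp: h_def k_def h1_def r_def powr_mult_base simp flip: powr_add)
    have k: "(k has_vector_derivative - (h1 x * r)) (at x)"
      using has_vector_derivative_powr[OF f1 f(2), OF x x, of "1/4"] by (simp add: k_def[abs_def] alg)
    note d = has_vector_derivative_of_real[OF h1[OF x, folded has_real_derivative_iff_has_vector_derivative]]
      has_vector_derivative_of_real[OF h2[OF x, folded has_real_derivative_iff_has_vector_derivative]]
      has_vector_derivative_of_real[OF k[folded has_real_derivative_iff_has_vector_derivative]] v[OF x] p[OF x]
    have "(u has_vector_derivative (of_real (h x) * (r *\<^sub>R p x) + of_real (h1 x) * v x)) (at x)"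
      unfolding u_def[abs_def] r_def by (intro has_vector_derivative_mult d)
    then show "(u has_vector_derivative u1 x) (at x)"
      by (simp add: u1_def scaleR_conv_of_real algebra_simps flip: alg(1))
    have k_psi: "of_real (k x) * psi f g x = - of_real (h2 x) + g x * h x"
      using alg(4) by (simp add: psi_eq[OF x] mult.assoc[symmetric] flip: of_real_mult)
    have "of_real (k x) * ((r + psi f g x) * v x) = (of_real (k x * r) + of_real (k x) * psi f g x) * v x"
      by (simp add: algebra_simps)
    also have "\<dots> = (of_real (f x) + g x) * u x - of_real (h2 x) * v x"
      unfolding k_psi alg(3) by (simp add: u_def algebra_simps)
    finally have "(of_real (h1 x) * (r *\<^sub>R p x) + of_real (h2 x) * v x) +
        (of_real (k x) * ((r + psi f g x) * v x) + of_real (- (h1 x * r)) * p x) = (of_real (f x) + g x) * u x"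
      by (simp add: scaleR_conv_of_real)
    moreover have "(u1 has_vector_derivative (of_real (h1 x) * (r *\<^sub>R p x) + of_real (h2 x) * v x) +
        (of_real (k x) * ((r + psi f g x) * v x) + of_real (- (h1 x * r)) * p x)) (at x)"
      unfolding u1_def[abs_def] r_def[symmetric]
      by (intro has_vector_derivative_add has_vector_derivative_mult d[folded r_def])
    ultimately show "(u1 has_vector_derivative (of_real (f x) + g x) * u x) (at x)"
      by simp
  qed
  have "continuous_on {0<..} u"
    using u1 by (auto intro!: continuous_at_imp_continuous_on has_vector_derivative_continuous)
  then have "continuous_on {0<..} (\<lambda>x. (of_real (f x) + g x) * u x)"
    by (intro continuous_intros f_cont g)
  then have "C2_on {0<..} u"
    unfolding C2_on_def using u1 u2 by (intro exI[of _ u1] exI[of _ "\<lambda>x. (of_real (f x) + g x) * u x"]) auto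
  moreover have "second_deriv u x = (of_real (f x) + g x) * u x" if "x > 0" for x
    using that u1 by (intro second_deriv_eqI[of "{0<..}", OF _ _ _ u2]) auto
  ultimately show "is_solution f g (\<lambda>x. of_real (f x powr (-1/4)) * v x)"
    unfolding is_solution_def u_def[abs_def] h_def by blast
qed

theorem proposition4p1:
  fixes f :: "real \<Rightarrow> real" and g :: "real \<Rightarrow> complex"
  assumes "C2_on {0<..} f"
    and "\<And>x. x > 0 \<Longrightarrow> f x > 0"
    and "continuous_on {0<..} g"
    and "psi f g absolutely_integrable_on {0<..}"
  shows "\<exists>u1 u2 :: real \<Rightarrow> complex.
    is_solution f g u1 \<and> is_solution f g u2 \<and>
    (let v1 = (\<lambda>x. of_real (\<bar>f x\<bar> powr (1/4)) * u1 x);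
         v2 = (\<lambda>x. of_real (\<bar>f x\<bar> powr (1/4)) * u2 x);
         S = (\<lambda>x. integral {x..1} (\<lambda>r. \<bar>f r\<bar> powr (1/2)))
     in ((\<lambda>x. of_real (exp (- S x)) * v1 x) \<longlongrightarrow> 1) (at_right 0) \<and>
        ((\<lambda>x. of_real (\<bar>f x\<bar> powr (-1/2) * exp (- S x)) * vector_derivative v1 (at x))
           \<longlongrightarrow> -1) (at_right 0) \<and>
        ((\<lambda>x. of_real (exp (S x)) * v2 x) \<longlongrightarrow> 1) (at_right 0) \<and>
        ((\<lambda>x. of_real (\<bar>f x\<bar> powr (-1/2) * exp (S x)) * vector_derivative v2 (at x))
           \<longlongrightarrow> 1) (at_right 0))"
proof -
  note f = assms(1,2) and g = assms(3)
  define r where "r x = f x powr (1/2)" for x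
  define q where "q = psi f g"
  define h where "h x = f x powr (-1/4)" for x
  have "\<exists>f'. \<forall>x>0. (f has_vector_derivative f' x) (at x)"
    using f(1) unfolding C2_on_def by (metis greaterThan_iff)
  then have f_cont: "continuous_on {0<..} f"
    by (auto intro!: continuous_at_imp_continuous_on intro: has_vector_derivative_continuous)
  have r: "continuous_on {0<..} r" "\<And>x. x > 0 \<Longrightarrow> r x > 0"
    by (auto simp: r_def intro!: continuous_intros f_cont dest: f(2))
  have q: "continuous_on {0<..} q" "q absolutely_integrable_on {0<..}"
    using continuous_on_psi[OF f g] assms(4) by (auto simp: q_def)
  \<comment> \<open>As an antiderivative, \<open>\<xi>\<close> is differentiable on the whole
    half-line. It agrees with the integral over \<open>{x..1}\<close> for \<open>x\<close> below 1,
    which suffices for limits at 0.\<close>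
  obtain \<xi> where \<xi>1: "\<xi> 1 = 0" and \<xi>_vec: "\<And>x. x > 0 \<Longrightarrow> (\<xi> has_vector_derivative - r x) (at x)"
    using antiderivative_exists[OF continuous_on_minus[OF r(1)], of 1] by auto
  have \<xi>: "\<And>x. x > 0 \<Longrightarrow> (\<xi> has_real_derivative - r x) (at x)"
    using \<xi>_vec by (simp add: has_real_derivative_iff_has_vector_derivative)
  have abs_f: "\<And>x. x > 0 \<Longrightarrow> \<bar>f x\<bar> = f x"
    using f(2) by (simp add: abs_of_pos)
  have r0: "\<And>x. x > 0 \<Longrightarrow> r x \<ge> 0"
    using r(2) by (simp add: less_imp_le)
  obtain v p :: "real \<Rightarrow> complex" where v': "\<And>x. x > 0 \<Longrightarrow> (v has_vector_derivative r x *\<^sub>R p x) (at x)"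
    and p': "\<And>x. x > 0 \<Longrightarrow> (p has_vector_derivative (r x + q x) * v x) (at x)"
    and v_lim: "((\<lambda>x. exp (\<xi> x) * v x) \<longlongrightarrow> 1) (at_right 0)"
    and p_lim: "((\<lambda>x. exp (\<xi> x) * p x) \<longlongrightarrow> 1) (at_right 0)"
    using recessive_solution[OF r0 \<xi> q] by auto
  have "\<forall>\<^sub>F x in at_right 0. exp (\<xi> x) * v x \<noteq> 0"
    using v_lim by (rule tendsto_imp_eventually_ne) simp
  then obtain b where "b > 0" "\<And>x. \<lbrakk>0 < x; x < b\<rbrakk> \<Longrightarrow> v x \<noteq> 0"
    unfolding eventually_at_right_field by auto
  then obtain x0 where x0: "x0 > 0" "v x0 \<noteq> 0"
    by (meson dense)
  have "continuous_on {0<..} (\<lambda>x. of_real (r x) + q x)"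
    by (intro continuous_intros r q)
  \<comment> \<open>With \<open>y x0 = 0\<close> the Wronskian at \<open>x0\<close> is
    \<open>v x0 * z x0\<close>, so this value of \<open>z x0\<close> makes it -2.\<close>
  from sturm_liouville_ivp[OF r(1) r0 this x0(1), of 0 "-2 / v x0"]
  obtain y z :: "real \<Rightarrow> complex" where init: "y x0 = 0" "z x0 = -2 / v x0"
    and y': "\<And>x. x > 0 \<Longrightarrow> (y has_vector_derivative r x *\<^sub>R z x) (at x)"
    and z': "\<And>x. x > 0 \<Longrightarrow> (z has_vector_derivative (r x + q x) * y x) (at x)"
    by auto
  have wronskian: "v x * z x - p x * y x = -2" if "x > 0" for x
  proof -
    have "v x * z x - p x * y x - (-2) = 0"
    proof (rule antiderivative_unique[where F = "\<lambda>x. v x * z x - p x * y x - (-2)" and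
          G = "\<lambda>_. 0" and h = "\<lambda>_. 0", OF x0(1) _ _ that])
      fix x :: real assume x: "x > 0"
      show "((\<lambda>x. v x * z x - p x * y x - (-2)) has_vector_derivative 0) (at x)"
        using has_vector_derivative_diff[OF has_vector_derivative_diff[OF
            has_vector_derivative_mult[OF v' z'] has_vector_derivative_mult[OF p' y']]
            has_vector_derivative_const[of "-2"], OF x x x x]
        by (simp add: algebra_simps scaleR_conv_of_real)
    qed (use init x0 in auto)
    then show ?thesis by (simp only: right_minus_eq)
  qed
  obtain c where y_lim: "((\<lambda>x. exp (- \<xi> x) * (y x + c * v x)) \<longlongrightarrow> 1) (at_right 0)"
    and z_lim: "((\<lambda>x. exp (- \<xi> x) * (z x + c * p x)) \<longlongrightarrow> -1) (at_right 0)"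
    using dominant_solution[OF r0 \<xi> v' y' wronskian v_lim p_lim] by auto
  define w where "w x = y x + c * v x" for x
  define s where "s x = z x + c * p x" for x
  have w': "(w has_vector_derivative r x *\<^sub>R s x) (at x)"
    and s': "(s has_vector_derivative (r x + q x) * w x) (at x)" if "x > 0" for x
    using has_vector_derivative_add[OF y' has_vector_derivative_mult[OF has_vector_derivative_const v'], OF that that, of c]
      has_vector_derivative_add[OF z' has_vector_derivative_mult[OF has_vector_derivative_const p'], OF that that, of c]
    unfolding w_def[abs_def] s_def[abs_def] by (simp_all add: algebra_simps)
  have solution: "is_solution f g (\<lambda>x. h x * v x)"
    if "\<And>x. x > 0 \<Longrightarrow> (v has_vector_derivative r x *\<^sub>R p x) (at x)"
      "\<And>x. x > 0 \<Longrightarrow> (p has_vector_derivative (r x + q x) * v x) (at x)" for v p :: "real \<Rightarrow> complex"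
    using that unfolding h_def r_def q_def by (intro is_solution_of_system[OF f g])
  define S where "S x = integral {x..1} (\<lambda>r. \<bar>f r\<bar> powr (1/2))" for x
  have S: "S x = \<xi> x" if "0 < x" "x < 1" for x
  proof -
    have "((\<lambda>t. - r t) has_integral (\<xi> 1 - \<xi> x)) {x..1}"
      using that \<xi>_vec by (intro fundamental_theorem_of_calculus)
        (auto intro: has_vector_derivative_at_within)
    then have "(r has_integral \<xi> x) {x..1}"
      using has_integral_neg[of "\<lambda>t. - r t"] \<xi>1 by force
    moreover have "S x = integral {x..1} r"
      unfolding S_def using that by (intro integral_cong) (simp add: r_def abs_f)
    ultimately show ?thesis by (simp add: integral_unique)
  qed
  \<comment> \<open>The factor \<open>|f| powr (1/4)\<close> undoes \<open>h\<close>, so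
    \<open>v1\<close> and \<open>v2\<close> of the theorem are components of the first-order
    system.\<close>
  have cancel: "of_real (\<bar>f x\<bar> powr (1/4)) * (of_real (h x) * v x) = v x" if "x > 0" for x and v :: "real \<Rightarrow> complex"
    using f(2)[OF that]
    by (simp add: h_def abs_f[OF that] mult.assoc[symmetric] flip: of_real_mult powr_add)
  \<comment> \<open>The sign \<open>e\<close> is -1 for the dominant and 1 for the recessive
    solution, so one transfer serves both.\<close>
  have lim_v: "((\<lambda>x. of_real (exp (e * S x)) * (of_real (\<bar>f x\<bar> powr (1/4)) * (of_real (h x) * v x))) \<longlongrightarrow> l) (at_right 0)"
    if "((\<lambda>x. of_real (exp (e * \<xi> x)) * v x) \<longlongrightarrow> l) (at_right 0)" for e l and v :: "real \<Rightarrow> complex"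
  proof (rule Lim_transform_eventually[OF that])
    show "\<forall>\<^sub>F x in at_right 0. of_real (exp (e * \<xi> x)) * v x =
        of_real (exp (e * S x)) * (of_real (\<bar>f x\<bar> powr (1/4)) * (of_real (h x) * v x))"
      unfolding eventually_at_right_field by (intro exI[of _ 1]) (simp add: S cancel)
  qed
  \<comment> \<open>The derivative in question is \<open>r * p\<close>, and
    \<open>|f| powr (-1/2)\<close> cancels \<open>r\<close>.\<close>
  have lim_p: "((\<lambda>x. of_real (\<bar>f x\<bar> powr (-1/2) * exp (e * S x)) *
      vector_derivative (\<lambda>x. of_real (\<bar>f x\<bar> powr (1/4)) * (of_real (h x) * v x)) (at x)) \<longlongrightarrow> l) (at_right 0)"
    if lim: "((\<lambda>x. of_real (exp (e * \<xi> x)) * p x) \<longlongrightarrow> l) (at_right 0)"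
      and v: "\<And>x. x > 0 \<Longrightarrow> (v has_vector_derivative r x *\<^sub>R p x) (at x)"
    for e l and v p :: "real \<Rightarrow> complex"
  proof (rule Lim_transform_eventually[OF lim])
    have "of_real (exp (e * \<xi> x)) * p x = of_real (\<bar>f x\<bar> powr (-1/2) * exp (e * S x)) *
      vector_derivative (\<lambda>x. of_real (\<bar>f x\<bar> powr (1/4)) * (of_real (h x) * v x)) (at x)"
      if x: "0 < x" "x < 1" for x
    proof -
      have "((\<lambda>x. of_real (\<bar>f x\<bar> powr (1/4)) * (of_real (h x) * v x)) has_vector_derivative r x *\<^sub>R p x) (at x)"
        by (rule has_vector_derivative_transform_within_open[OF v, of _ "{0<..}"]) (use x cancel in auto)
      then have "vector_derivative (\<lambda>x. of_real (\<bar>f x\<bar> powr (1/4)) * (of_real (h x) * v x)) (at x) = r x *\<^sub>R p x"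
        by (rule vector_derivative_at)
      moreover have "\<bar>f x\<bar> powr (-1/2) * exp (e * S x) * r x = exp (e * \<xi> x)"
        using f(2)[OF x(1)] S[OF x] by (simp add: r_def abs_f mult.commute mult.left_commute flip: powr_add)
      ultimately show ?thesis
        by (simp add: scaleR_conv_of_real mult.assoc[symmetric] flip: of_real_mult)
    qed
    then show "\<forall>\<^sub>F x in at_right 0. of_real (exp (e * \<xi> x)) * p x =
      of_real (\<bar>f x\<bar> powr (-1/2) * exp (e * S x)) *
      vector_derivative (\<lambda>x. of_real (\<bar>f x\<bar> powr (1/4)) * (of_real (h x) * v x)) (at x)"
      unfolding eventually_at_right_field by (intro exI[of _ 1]) simp
  qed
  have w_lim: "((\<lambda>x. exp (-1 * \<xi> x) * w x) \<longlongrightarrow> 1) (at_right 0)"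
    "((\<lambda>x. exp (-1 * \<xi> x) * s x) \<longlongrightarrow> -1) (at_right 0)"
    "((\<lambda>x. exp (1 * \<xi> x) * v x) \<longlongrightarrow> 1) (at_right 0)"
    "((\<lambda>x. exp (1 * \<xi> x) * p x) \<longlongrightarrow> 1) (at_right 0)"
    using y_lim z_lim v_lim p_lim by (simp_all add: w_def s_def)
  \<comment> \<open>The dominant solution \<open>h * w\<close> is \<open>u1\<close> and the
    recessive \<open>h * v\<close> is \<open>u2\<close>.\<close>
  show ?thesis
    unfolding Let_def S_def[symmetric]
    using solution[OF w' s'] solution[OF v' p'] lim_v[OF w_lim(1)] lim_p[OF w_lim(2) w']
      lim_v[OF w_lim(3)] lim_p[OF w_lim(4) v']
    by (intro exI[of _ "\<lambda>x. h x * w x"] exI[of _ "\<lambda>x. h x * v x"]) simp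
qed

end
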